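(* Let $M=(\Omega,P)$ be a Markov chain with an observation function $O:\Omega\to\Sigma$. Then there exists a canonical Markov chain $\hat M=(\hat\Omega,\hat P)$ and an injective map $\phi:\Omega\to\hat\Omega$ such that for any two states $a,a'\in\Omega$, $$\mathrm{AQC}_{\hat M}(\phi(a),\phi(a'))=\Theta\bigl(|\Sigma|\cdot\mathrm{AQC}_M(a,a')\bigr).$$
   Context: A partially observable Markov chain $(\Omega,P,O)$ has finite state space $\Omega$, transition probabilities $P$ (from state $y$ the next state is drawn from $P(\cdot\mid y)$), and deterministic observation function $O:\Omega\to\Sigma$; states are hidden, only observations are visible. A canonical Markov chain is one with a sink state $s$ ($P(s\mid s)=1$) and observation function $O(x)=1$ if $x=s$, $0$ otherwise. A rewinding strategy is a (possibly randomized) function $A:\Sigma^*\to\mathbb{Z}_{\ge0}$: from initial state $X_0$, for $t\ge0$ set $Z_t=O(X_t)$ and draw $X_{t+1}\sim P(\cdot\mid X_{t'})$ with $t'=\max\{0,t-A(Z_0,\dots,Z_t)\}$, independently of everything else given $X_{t'}$ (each draw is a query). $\mathrm{QC}^A(a,b)$ is the least $T$ such that the total variation distance between $(Z_0,\dots,Z_T)$ under $X_0=a$ and under $X_0=b$ is at least $1/3$, and $\mathrm{AQC}(a,b)=\min_A\mathrm{QC}^A(a,b)$ over all rewinding strategies.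
   Formalization: AQC_M(a,a') on the right-hand side is replaced by max(1, AQC_M(a,a')): when O(a) ≠ O(a') the query complexity is 0, and the literal Θ(0) fails for three states with three different observations; there the bound proved is Θ(|Σ|). *)

theory Defs
  imports "HOL-Probability.Probability"
begin

record ('a, 'o) pomc =
  states :: "'a set"
  kernel :: "'a \<Rightarrow> 'a pmf"
  alphabet :: "'o set"
  obs :: "'a \<Rightarrow> 'o"

definition pomc :: "('a, 'o) pomc \<Rightarrow> bool" where
  "pomc M \<longleftrightarrow>
     finite (states M) \<and> finite (alphabet M) \<and>
     (\<forall>x\<in>states M. set_pmf (kernel M x) \<subseteq> states M) \<and>
     obs M ` states M \<subseteq> alphabet M"

definition canonical :: "('a, nat) pomc \<Rightarrow> bool" where
  "canonical M \<longleftrightarrow>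
     pomc M \<and> alphabet M = {0, 1} \<and>
     (\<exists>s\<in>states M. kernel M s = return_pmf s \<and>
        (\<forall>x\<in>states M. obs M x = (if x = s then 1 else 0)))"

text \<open>
  The law of \<open>[X\<^sub>0, \<dots>, X\<^sub>t]\<close> from \<open>X\<^sub>0 = a\<close> under a deterministic strategy \<open>A\<close>. The
  truncating subtraction on \<^typ>\<open>nat\<close> is the rewinding index \<open>max {0, t - A (Z\<^sub>0, \<dots>, Z\<^sub>t)}\<close>.
\<close>

primrec history :: "('a, 'o) pomc \<Rightarrow> ('o list \<Rightarrow> nat) \<Rightarrow> 'a \<Rightarrow> nat \<Rightarrow> 'a list pmf" where
  "history M A a 0 = return_pmf [a]"
| "history M A a (Suc t) =
     bind_pmf (history M A a t)
       (\<lambda>xs. map_pmf (\<lambda>y. xs @ [y]) (kernel M (xs ! (t - A (map (obs M) xs)))))"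

text \<open>
  A randomized strategy is a random function, given by its distribution on the product
  \<open>\<sigma>\<close>-algebra; deterministic strategies are the point masses, and strategies that use fresh
  independent randomness at every call are the product measures.
\<close>

definition strategies :: "('o list \<Rightarrow> nat) measure set" where
  "strategies = {N. prob_space N \<and> sets N = sets (Pi\<^sub>M UNIV (\<lambda>_. count_space UNIV))}"

text \<open>
  The probability that \<open>[Z\<^sub>0, \<dots>, Z\<^sub>T] = w\<close>. If \<open>pomc M\<close> and
  \<open>a \<in> states M\<close>, the integrand depends on finitely many values of \<open>A\<close>, so it is measurable.
\<close>

definition obs_prob ::
    "('a, 'o) pomc \<Rightarrow> ('o list \<Rightarrow> nat) measure \<Rightarrow> 'a \<Rightarrow> nat \<Rightarrow> 'o list \<Rightarrow> real" where
  "obs_prob M N a T w = (\<integral>A. pmf (map_pmf (map (obs M)) (history M A a T)) w \<partial>N)"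

definition obs_tv ::
    "('a, 'o) pomc \<Rightarrow> ('o list \<Rightarrow> nat) measure \<Rightarrow> 'a \<Rightarrow> 'a \<Rightarrow> nat \<Rightarrow> real" where
  "obs_tv M N a b T =
     (\<Sum>w | set w \<subseteq> alphabet M \<and> length w = Suc T.
        \<bar>obs_prob M N a T w - obs_prob M N b T w\<bar>) / 2"

text \<open>
  The infimum of the empty set is \<open>\<infinity>\<close>, so indistinguishable states get query complexity \<open>\<infinity>\<close>.
  States with different observations are distinguished by \<open>Z\<^sub>0\<close>, without any query, and get \<open>0\<close>.
  No canonical chain can reproduce \<open>0\<close> for three states with pairwise different observations, so
  a multiplicative comparison has to use \<open>max 1 (AQC M a b)\<close>.
\<close>

definition QC :: "('a, 'o) pomc \<Rightarrow> ('o list \<Rightarrow> nat) measure \<Rightarrow> 'a \<Rightarrow> 'a \<Rightarrow> enat" where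
  "QC M N a b = Inf {enat T |T. obs_tv M N a b T \<ge> 1 / 3}"

definition AQC :: "('a, 'o) pomc \<Rightarrow> 'a \<Rightarrow> 'a \<Rightarrow> enat" where
  "AQC M a b = (INF N\<in>strategies. QC M N a b)"

end

theory Submission
  imports Defs
begin

text \<open>
  After fixing the random choices of the strategy, comparing the initial states \<open>a\<close> and \<open>b\<close> means
  following a signed measure on tuples of visited states: it starts as \<open>\<delta>\<^sub>a - \<delta>\<^sub>b\<close>, a query
  appends a sample, and the new observation splits it. Its value with \<open>m\<close> queries left is a
  seminorm \<open>V m\<close>, and \<open>AQC a b \<le> T\<close> means that the initial value with \<open>T\<close> queries is at least \<open>2/3\<close>.

  In the canonical chain every state becomes a path of length \<open>k = card \<Sigma>\<close>, at the end of which a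
  fair coin decides between moving to a sampled successor and a countdown to the sink whose length
  encodes the observation. No information on a sampled state is available before its path has been
  completed, which costs \<open>k + 1\<close> queries, so \<open>(k + 1) m\<close> queries are simulated by \<open>m\<close> queries of the
  original chain: samples are drawn lazily. Conversely, from the end of a path, \<open>k + 1\<close> queries
  either reveal the observation or produce a fresh successor, with probability \<open>1/2\<close> each and
  independently of the hidden states; by Markov's inequality a run of a constant multiple of the
  expected length fails with small probability. The loss is compensated beforehand by three independent
  repetitions, which raise the total variation distance from \<open>1/3\<close> to \<open>2/5\<close>.
\<close>

section \<open>The value of a signed measure on configurations\<close>

text \<open>A signed measure on tuples is represented by its integration functional on test
  functions. Configurations are total sequences, so a growing tuple keeps one type; the number
  \<open>n\<close> of coordinates in use is carried separately.\<close>

type_synonym 'a functional = "((nat \<Rightarrow> 'a) \<Rightarrow> real) \<Rightarrow> real"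

definition lin :: "'a functional \<Rightarrow> bool" where
  "lin F \<longleftrightarrow> (\<forall>g h. F (\<lambda>c. g c + h c) = F g + F h) \<and> (\<forall>r g. F (\<lambda>c. r * g c) = r * F g)"

lemma lin_add: "lin F \<Longrightarrow> F (\<lambda>c. g c + h c) = F g + F h"
  and lin_scale: "lin F \<Longrightarrow> F (\<lambda>c. r * g c) = r * F g"
  by (auto simp: lin_def)

lemma lin_zero: "lin F \<Longrightarrow> F (\<lambda>c. 0) = 0"
  using lin_scale[of F 0 "\<lambda>_. 0"] by simp

lemma lin_sum: "lin F \<Longrightarrow> F (\<lambda>c. \<Sum>i\<in>I. g i c) = (\<Sum>i\<in>I. F (g i))"
proof (induction I rule: infinite_finite_induct)
  case (insert i I)
  have "F (\<lambda>c. g i c + (\<Sum>i\<in>I. g i c)) = F (g i) + F (\<lambda>c. \<Sum>i\<in>I. g i c)"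
    by (rule lin_add[OF insert.prems])
  with insert show ?case by simp
qed (simp_all add: lin_zero)

lemma lin_const: "lin F \<Longrightarrow> F (\<lambda>c. r) = r * F (\<lambda>c. 1)"
  using lin_scale[of F r "\<lambda>_. 1"] by simp

lemma lin_pull: "lin F \<Longrightarrow> lin (\<lambda>g. F (\<lambda>c. g (f c)))"
  by (auto simp: lin_def)

lemma lin_eval: "lin (\<lambda>g. g x)"
  by (auto simp: lin_def)

definition loc :: "nat \<Rightarrow> ((nat \<Rightarrow> 'a) \<Rightarrow> real) \<Rightarrow> bool" where
  "loc n g \<longleftrightarrow> (\<forall>c c'. (\<forall>i<n. c i = c' i) \<longrightarrow> g c = g c')"

text \<open>The signed measure is concentrated on \<open>Q\<close>, phrased through test
  functions.\<close>

definition carried :: "'a functional \<Rightarrow> ((nat \<Rightarrow> 'a) \<Rightarrow> bool) \<Rightarrow> bool" where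
  "carried F Q \<longleftrightarrow> (\<forall>g h. (\<forall>c. Q c \<longrightarrow> g c = h c) \<longrightarrow> F g = F h)"

lemma carriedD: "carried F Q \<Longrightarrow> (\<And>c. Q c \<Longrightarrow> g c = h c) \<Longrightarrow> F g = F h"
  by (auto simp: carried_def)

text \<open>\<open>E x\<close> is the expectation under the kernel at \<open>x\<close>, axiomatized
  for every \<open>x\<close> of the type, so that no membership in a state space has to be tracked.
  \<open>E_cong_obs\<close> says that a sampled successor has its observation in
  \<open>Sg\<close>.\<close>

locale query_system =
  fixes E :: "'a \<Rightarrow> ('a \<Rightarrow> real) \<Rightarrow> real" and ob :: "'a \<Rightarrow> 'o" and Sg :: "'o set"
  assumes finite_Sg: "finite Sg"
    and E_add: "E x (\<lambda>y. g y + h y) = E x g + E x h"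
    and E_scale: "E x (\<lambda>y. r * g y) = r * E x g"
    and E_one: "E x (\<lambda>y. 1) = 1"
    and E_cong_obs: "(\<And>y. ob y \<in> Sg \<Longrightarrow> g y = h y) \<Longrightarrow> E x g = E x h"
begin

lemma E_cong: "(\<And>y. g y = h y) \<Longrightarrow> E x g = E x h"
  using E_cong_obs by blast

lemma E_const: "E x (\<lambda>y. r) = r"
  using E_scale[of x r "\<lambda>_. 1"] E_one by simp

definition sample :: "nat \<Rightarrow> nat \<Rightarrow> 'a functional \<Rightarrow> 'a functional" where
  "sample u n F = (\<lambda>g. F (\<lambda>c. E (c u) (\<lambda>y. g (c(n := y)))))"

text \<open>Restriction to an event without renormalization: the probability of the observation
  stays in the total mass.\<close>

definition reveal :: "nat \<Rightarrow> 'o \<Rightarrow> 'a functional \<Rightarrow> 'a functional" where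
  "reveal p z F = (\<lambda>g. F (\<lambda>c. if ob (c p) = z then g c else 0))"

definition step :: "nat \<Rightarrow> nat \<Rightarrow> 'o \<Rightarrow> 'a functional \<Rightarrow> 'a functional" where
  "step u n z F = reveal n z (sample u n F)"

lemma step_apply: "step u n z F g = F (\<lambda>c. E (c u) (\<lambda>y. if ob y = z then g (c(n := y)) else 0))"
  by (simp add: step_def reveal_def sample_def)

text \<open>Coordinates below \<open>n\<close> are in use and \<open>m\<close> queries remain.
  Unfolded, this is the sum of the absolute masses of all observation words under the best adaptive
  choice of queries, hence twice a total variation distance when \<open>F\<close> is a difference of
  two probability laws. \<open>Max\<close> ranges over a nonempty set only if
  \<open>0 < n\<close>.\<close>

fun V :: "nat \<Rightarrow> nat \<Rightarrow> 'a functional \<Rightarrow> real" where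
  "V 0 n F = \<bar>F (\<lambda>_. 1)\<bar>"
| "V (Suc m) n F = Max ((\<lambda>u. \<Sum>z\<in>Sg. V m (Suc n) (step u n z F)) ` {..<n})"

lemma lin_sample: "lin F \<Longrightarrow> lin (sample u n F)"
  by (auto simp: lin_def sample_def E_add E_scale)

lemma lin_reveal:
  assumes "lin F" shows "lin (reveal p z F)"
proof -
  have "reveal p z F = (\<lambda>g. F (\<lambda>c. (if ob (c p) = z then 1 else 0) * g c))"
    by (auto simp: reveal_def intro!: ext arg_cong[where f=F])
  then show ?thesis
    using assms by (simp add: lin_def algebra_simps)
qed

lemma lin_step: "lin F \<Longrightarrow> lin (step u n z F)"
  by (simp add: step_def lin_sample lin_reveal)

lemma V_ge_query: "u < n \<Longrightarrow> (\<Sum>z\<in>Sg. V m (Suc n) (step u n z F)) \<le> V (Suc m) n F"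
  by (auto intro!: Max_ge)

lemma V_query_obtain:
  assumes "0 < n"
  obtains u where "u < n" "V (Suc m) n F = (\<Sum>z\<in>Sg. V m (Suc n) (step u n z F))"
proof -
  have "V (Suc m) n F \<in> (\<lambda>u. \<Sum>z\<in>Sg. V m (Suc n) (step u n z F)) ` {..<n}"
    unfolding V.simps using assms by (intro Max_in) auto
  then show ?thesis using that by auto
qed

lemma V_nonneg: "0 < n \<Longrightarrow> 0 \<le> V m n F"
proof (induction m arbitrary: n F)
  case (Suc m)
  obtain u where "V (Suc m) n F = (\<Sum>z\<in>Sg. V m (Suc n) (step u n z F))"
    using V_query_obtain Suc.prems by blast
  then show ?case using Suc.IH by (simp add: sum_nonneg del: V.simps)
qed simp

lemma V_add: "0 < n \<Longrightarrow> V m n (\<lambda>g. F g + G g) \<le> V m n F + V m n G"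
proof (induction m arbitrary: n F G)
  case (Suc m)
  obtain u where u: "u < n" and
    eq: "V (Suc m) n (\<lambda>g. F g + G g) = (\<Sum>z\<in>Sg. V m (Suc n) (step u n z (\<lambda>g. F g + G g)))"
    using V_query_obtain Suc.prems by blast
  have "step u n z (\<lambda>g. F g + G g) = (\<lambda>g. step u n z F g + step u n z G g)" for z
    by (simp add: step_apply fun_eq_iff)
  then have "V (Suc m) n (\<lambda>g. F g + G g)
      \<le> (\<Sum>z\<in>Sg. V m (Suc n) (step u n z F) + V m (Suc n) (step u n z G))"
    unfolding eq using Suc.IH by (intro sum_mono) simp
  also have "\<dots> \<le> V (Suc m) n F + V (Suc m) n G"
    unfolding sum.distrib using V_ge_query[OF u] by (intro add_mono) blast+
  finally show ?case .
qed simp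

lemma V_scale: "0 < n \<Longrightarrow> V m n (\<lambda>g. r * F g) = \<bar>r\<bar> * V m n F"
proof (induction m arbitrary: n F)
  case (Suc m)
  have "step u n z (\<lambda>g. r * F g) = (\<lambda>g. r * step u n z F g)" for u z
    by (simp add: step_apply fun_eq_iff)
  then have *: "(\<Sum>z\<in>Sg. V m (Suc n) (step u n z (\<lambda>g. r * F g)))
      = \<bar>r\<bar> * (\<Sum>z\<in>Sg. V m (Suc n) (step u n z F))" for u
    using Suc.IH by (simp add: sum_distrib_left)
  obtain u where u: "u < n" "V (Suc m) n (\<lambda>g. r * F g) = (\<Sum>z\<in>Sg. V m (Suc n) (step u n z (\<lambda>g. r * F g)))"
    using V_query_obtain Suc.prems by blast
  obtain v where v: "v < n" "V (Suc m) n F = (\<Sum>z\<in>Sg. V m (Suc n) (step v n z F))"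
    using V_query_obtain Suc.prems by blast
  show ?case
  proof (rule antisym)
    show "V (Suc m) n (\<lambda>g. r * F g) \<le> \<bar>r\<bar> * V (Suc m) n F"
      unfolding u(2) * using V_ge_query[OF u(1)] by (intro mult_left_mono) auto
    show "\<bar>r\<bar> * V (Suc m) n F \<le> V (Suc m) n (\<lambda>g. r * F g)"
      unfolding v(2) *[symmetric] by (rule V_ge_query[OF v(1)])
  qed
qed (simp add: abs_mult)

lemma V_zero: "0 < n \<Longrightarrow> V m n (\<lambda>g. 0) = 0"
  using V_scale[of n m 0 "\<lambda>_. 0"] by simp

lemma V_sum: "0 < n \<Longrightarrow> V m n (\<lambda>g. \<Sum>i\<in>I. F i g) \<le> (\<Sum>i\<in>I. V m n (F i))"
proof (induction I rule: infinite_finite_induct)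
  case (insert i I)
  have "V m n (\<lambda>g. F i g + (\<Sum>i\<in>I. F i g)) \<le> V m n (F i) + V m n (\<lambda>g. \<Sum>i\<in>I. F i g)"
    using V_add[OF \<open>0 < n\<close>] .
  with insert show ?case by fastforce
qed (auto simp: V_zero)

lemma sum_reveal:
  assumes F: "lin F" and p: "carried F (\<lambda>c. ob (c p) \<in> Sg)"
  shows "(\<Sum>z\<in>Sg. reveal p z F g) = F g"
proof -
  have "(\<Sum>z\<in>Sg. reveal p z F g) = F (\<lambda>c. \<Sum>z\<in>Sg. if ob (c p) = z then g c else 0)"
    unfolding reveal_def by (rule lin_sum[OF F, symmetric])
  also have "\<dots> = F g"
    using finite_Sg by (intro carriedD[OF p]) simp
  finally show ?thesis .
qed

lemma carried_sample_obs: "carried (sample u n F) (\<lambda>c. ob (c n) \<in> Sg)"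
  unfolding carried_def sample_def by (auto intro!: arg_cong[where f=F] ext E_cong_obs)

lemma sum_step: "lin F \<Longrightarrow> (\<Sum>z\<in>Sg. step u n z F g) = sample u n F g"
  unfolding step_def by (intro sum_reveal lin_sample carried_sample_obs)

lemma V_le_sum_reveal:
  assumes "lin F" "carried F (\<lambda>c. ob (c p) \<in> Sg)" "0 < n"
  shows "V m n F \<le> (\<Sum>z\<in>Sg. V m n (reveal p z F))"
proof -
  have "F = (\<lambda>g. \<Sum>z\<in>Sg. reveal p z F g)"
    using sum_reveal[OF assms(1,2)] by auto
  then have "V m n F = V m n (\<lambda>g. \<Sum>z\<in>Sg. reveal p z F g)" by simp
  also have "\<dots> \<le> (\<Sum>z\<in>Sg. V m n (reveal p z F))"
    by (rule V_sum[OF assms(3)])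
  finally show ?thesis .
qed

text \<open>A strategy that sees only the coordinates selected by \<open>\<pi>\<close> can be run on
  the full tuple: a query to \<open>u\<close> becomes a query to \<open>\<pi> u\<close>. This covers
  forgetting and overwriting of coordinates. The functionals are compared on local test functions
  only, since the coordinates from \<open>n'\<close> on carry no information.\<close>

lemma V_reindex:
  assumes "0 < n'" "\<And>i. i < n' \<Longrightarrow> \<pi> i < n"
    and "\<And>g. loc n' g \<Longrightarrow> F' g = F (\<lambda>c. g (c \<circ> \<pi>))"
  shows "V m n' F' \<le> V m n F"
  using assms
proof (induction m arbitrary: n' n \<pi> F F')
  case 0
  have "loc n' (\<lambda>_. 1)" by (simp add: loc_def)
  from "0.prems"(3)[OF this] show ?case by simp
next
  case (Suc m)
  obtain u where u: "u < n'"
    and eq: "V (Suc m) n' F' = (\<Sum>z\<in>Sg. V m (Suc n') (step u n' z F'))"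
    using V_query_obtain Suc.prems by blast
  have "V m (Suc n') (step u n' z F') \<le> V m (Suc n) (step (\<pi> u) n z F)" for z
  proof (rule Suc.IH)
    \<comment> \<open>The answer occupies coordinate \<open>n'\<close> of the small tuple and
      \<open>n\<close> of the large one.\<close>
    show "(\<pi>(n' := n)) i < Suc n" if "i < Suc n'" for i
      using that Suc.prems(2)[of i] by (auto simp: less_Suc_eq)
    fix g :: "(nat \<Rightarrow> 'a) \<Rightarrow> real" assume g: "loc (Suc n') g"
    have "loc n' (\<lambda>c. E (c u) (\<lambda>y. if ob y = z then g (c(n' := y)) else 0))"
      unfolding loc_def
    proof (intro allI impI)
      fix c c' :: "nat \<Rightarrow> 'a" assume c: "\<forall>i<n'. c i = c' i"
      then have "g (c(n' := y)) = g (c'(n' := y))" for y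
        by (intro g[unfolded loc_def, rule_format]) (auto simp: less_Suc_eq)
      moreover have "c u = c' u" using c u by blast
      ultimately show "E (c u) (\<lambda>y. if ob y = z then g (c(n' := y)) else 0)
        = E (c' u) (\<lambda>y. if ob y = z then g (c'(n' := y)) else 0)" by presburger
    qed
    from Suc.prems(3)[OF this]
    have *: "step u n' z F' g
        = F (\<lambda>c. E (c (\<pi> u)) (\<lambda>y. if ob y = z then g ((c \<circ> \<pi>)(n' := y)) else 0))"
      by (simp add: step_apply)
    have "g ((c \<circ> \<pi>)(n' := y)) = g ((c(n := y)) \<circ> \<pi>(n' := n))" for c y
      using Suc.prems(2) by (intro g[unfolded loc_def, rule_format]) (auto simp: less_Suc_eq)
    then show "step u n' z F' g = step (\<pi> u) n z F (\<lambda>c. g (c \<circ> \<pi>(n' := n)))"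
      unfolding * unfolding step_apply by (intro arg_cong[where f=F] ext E_cong) simp
  qed simp
  then have "V (Suc m) n' F' \<le> (\<Sum>z\<in>Sg. V m (Suc n) (step (\<pi> u) n z F))"
    unfolding eq by (rule sum_mono)
  also have "\<dots> \<le> V (Suc m) n F"
    by (rule V_ge_query[OF Suc.prems(2)[OF u]])
  finally show ?case .
qed

lemma sample_forget:
  "sample u n F (\<lambda>c. g c) = F g" if "loc n g"
proof -
  have "g (c(n := y)) = g c" for c y
    using that by (auto simp: loc_def)
  then show ?thesis by (simp add: sample_def E_const)
qed

lemma V_sample_ge:
  assumes "0 < n" shows "V m n F \<le> V m (Suc n) (sample u n F)"
  using assms by (rule V_reindex[where \<pi>=id]) (auto simp: sample_forget)

text \<open>One more query is made and its answer ignored; splitting by the revealed observation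
  cannot lower the value, by the triangle inequality.\<close>

lemma V_Suc_ge:
  assumes "0 < n" "lin F" shows "V m n F \<le> V (Suc m) n F"
proof -
  have "V m n F \<le> V m (Suc n) (sample 0 n F)" by (rule V_sample_ge[OF assms(1)])
  also have "\<dots> \<le> (\<Sum>z\<in>Sg. V m (Suc n) (step 0 n z F))"
    unfolding step_def by (intro V_le_sum_reveal lin_sample carried_sample_obs assms(2)) simp
  also have "\<dots> \<le> V (Suc m) n F"
    by (rule V_ge_query[OF assms(1)])
  finally show ?thesis .
qed

lemma V_mono:
  assumes "0 < n" "lin F" "m \<le> m'" shows "V m n F \<le> V m' n F"
  using assms(3) by (rule lift_Suc_mono_le[rotated]) (rule V_Suc_ge[OF assms(1,2)])

end

section \<open>Amplification by repetition\<close>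

context query_system
begin

lemma carried_sample:
  assumes "carried F Q" "\<And>c y. Q c \<Longrightarrow> Q (c(n := y))"
  shows "carried (sample u n F) Q"
  unfolding carried_def sample_def
proof (intro allI impI)
  fix g h :: "(nat \<Rightarrow> 'a) \<Rightarrow> real" assume gh: "\<forall>c. Q c \<longrightarrow> g c = h c"
  show "F (\<lambda>c. E (c u) (\<lambda>y. g (c(n := y)))) = F (\<lambda>c. E (c u) (\<lambda>y. h (c(n := y))))"
  proof (rule carriedD[OF assms(1)])
    fix c assume "Q c"
    then show "E (c u) (\<lambda>y. g (c(n := y))) = E (c u) (\<lambda>y. h (c(n := y)))"
      using assms(2) gh by (intro E_cong) blast
  qed
qed

lemma carried_reveal:
  assumes "carried F Q"
  shows "carried (reveal p z F) (\<lambda>c. Q c \<and> ob (c p) = z)"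
  unfolding carried_def reveal_def by (auto intro!: carriedD[OF assms])

lemma carried_step:
  assumes "carried F Q" "\<And>c y. Q c \<Longrightarrow> Q (c(n := y))"
  shows "carried (step u n z F) (\<lambda>c. Q c \<and> ob (c n) = z)"
  unfolding step_def by (intro carried_reveal carried_sample assms)

lemma carried_weaken: "carried F Q \<Longrightarrow> (\<And>c. Q c \<Longrightarrow> R c) \<Longrightarrow> carried F R"
  by (auto simp: carried_def)

section \<open>Tests between two weighted hypotheses at the root\<close>

definition root_value :: "nat \<Rightarrow> 'a \<Rightarrow> 'a \<Rightarrow> real \<Rightarrow> real \<Rightarrow> real" where
  "root_value m a b p q = V m 1 (\<lambda>g. p * g (\<lambda>_. a) - q * g (\<lambda>_. b))"

lemma root_value_add:
  "root_value m a b (p + p') (q + q') \<le> root_value m a b p q + root_value m a b p' q'"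
proof -
  have "(\<lambda>g. (p + p') * g (\<lambda>_. a) - (q + q') * g (\<lambda>_. b))
      = (\<lambda>g. (p * g (\<lambda>_. a) - q * g (\<lambda>_. b)) + (p' * g (\<lambda>_. a) - q' * g (\<lambda>_. b)))"
    by (rule ext) (simp add: distrib_right)
  from arg_cong[OF this, of "V m 1"] show ?thesis
    unfolding root_value_def by (rule ord_eq_le_trans) (simp add: V_add)
qed

lemma root_value_zero: "root_value m a b 0 0 = 0"
  by (simp add: root_value_def V_zero)

lemma root_value_sum:
  "finite I \<Longrightarrow> root_value m a b (\<Sum>i\<in>I. p i) (\<Sum>i\<in>I. q i) \<le> (\<Sum>i\<in>I. root_value m a b (p i) (q i))"
proof (induction I rule: finite_induct)
  case (insert i I)
  then show ?case
    using root_value_add[of m a b "p i" "sum p I" "q i" "sum q I"] by simp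
qed (simp add: root_value_zero)

text \<open>After any run the root still sits in coordinate 0 under both hypotheses. Everything else
  can be discarded by the constant reindexing, keeping the likelihoods of the run as
  weights.\<close>

lemma root_value_le_V:
  assumes "lin Fa" "lin Fb" "carried Fa (\<lambda>c. c 0 = a)" "carried Fb (\<lambda>c. c 0 = b)" "0 < n"
  shows "root_value m a b (p * Fa (\<lambda>_. 1)) (q * Fb (\<lambda>_. 1)) \<le> V m n (\<lambda>g. p * Fa g - q * Fb g)"
  unfolding root_value_def
proof (rule V_reindex[where \<pi>="\<lambda>_. 0"])
  fix g :: "(nat \<Rightarrow> 'a) \<Rightarrow> real"
  have "Fa (\<lambda>c. g (c \<circ> (\<lambda>_. 0))) = Fa (\<lambda>c. g (\<lambda>_. a))"
    by (rule carriedD[OF assms(3)]) (simp add: o_def)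
  moreover have "Fb (\<lambda>c. g (c \<circ> (\<lambda>_. 0))) = Fb (\<lambda>c. g (\<lambda>_. b))"
    by (rule carriedD[OF assms(4)]) (simp add: o_def)
  ultimately show "p * Fa (\<lambda>_. 1) * g (\<lambda>_. a) - q * Fb (\<lambda>_. 1) * g (\<lambda>_. b)
      = p * Fa (\<lambda>c. g (c \<circ> (\<lambda>_. 0))) - q * Fb (\<lambda>c. g (c \<circ> (\<lambda>_. 0)))"
    using lin_const[OF assms(1), of "g (\<lambda>_. a)"] lin_const[OF assms(2), of "g (\<lambda>_. b)"] by simp
qed (use assms(5) in auto)

text \<open>Twice the largest total variation distance reachable with \<open>m\<close> queries; the
  observation of the initial state is split off first because it is free.\<close>

definition full_value :: "nat \<Rightarrow> 'a \<Rightarrow> 'a \<Rightarrow> real" where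
  "full_value m a b = (\<Sum>z\<in>Sg. V m 1 (reveal 0 z (\<lambda>g. g (\<lambda>_. a) - g (\<lambda>_. b))))"

text \<open>
  An optimal strategy together with its likelihood test: \<open>\<alpha>\<close> and \<open>\<beta>\<close> are the masses that the
  two hypotheses give to the acceptance region. After running it, one may start afresh from the
  root with the two hypotheses reweighted according to the outcome of the test.
\<close>

lemma split_by_test:
  assumes "lin Fa" "lin Fb" "carried Fa (\<lambda>c. c 0 = a)" "carried Fb (\<lambda>c. c 0 = b)" "0 < n"
  shows "\<exists>\<alpha> \<beta>. 2 * (\<alpha> - \<beta>) = V m n (\<lambda>g. Fa g - Fb g) + Fa (\<lambda>_. 1) - Fb (\<lambda>_. 1) \<and>
    (\<forall>p q s. root_value s a b (p * \<alpha>) (q * \<beta>)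
       + root_value s a b (p * (Fa (\<lambda>_. 1) - \<alpha>)) (q * (Fb (\<lambda>_. 1) - \<beta>))
       \<le> V (m + s) n (\<lambda>g. p * Fa g - q * Fb g))"
  using assms
proof (induction m arbitrary: n Fa Fb)
  case 0
  note rv = root_value_le_V[OF "0.prems"]
  \<comment> \<open>Without queries the likelihood test accepts everything or nothing, according to
    which mass is larger.\<close>
  show ?case
  proof (cases "Fb (\<lambda>_. 1) \<le> Fa (\<lambda>_. 1)")
    case True
    then show ?thesis
      using rv by (intro exI[of _ "Fa (\<lambda>_. 1)"] exI[of _ "Fb (\<lambda>_. 1)"]) (simp add: root_value_zero)
  next
    case False
    then show ?thesis
      using rv by (intro exI[of _ 0]) (simp add: root_value_zero)
  qed
next
  case (Suc m)
  obtain u where u: "u < n" and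
    eq: "V (Suc m) n (\<lambda>g. Fa g - Fb g) = (\<Sum>z\<in>Sg. V m (Suc n) (step u n z (\<lambda>g. Fa g - Fb g)))"
    using V_query_obtain Suc.prems by blast
  let ?Fa = "\<lambda>z. step u n z Fa" and ?Fb = "\<lambda>z. step u n z Fb"
  have lins: "lin (?Fa z)" "lin (?Fb z)" for z
    using Suc.prems by (simp_all add: lin_step)
  have carr: "carried (?Fa z) (\<lambda>c. c 0 = a)" "carried (?Fb z) (\<lambda>c. c 0 = b)" for z
    using Suc.prems by (auto intro!: carried_weaken[OF carried_step])
  define test where "test = (\<lambda>z (\<alpha>, \<beta>).
    2 * (\<alpha> - \<beta>) = V m (Suc n) (\<lambda>g. ?Fa z g - ?Fb z g) + ?Fa z (\<lambda>_. 1) - ?Fb z (\<lambda>_. 1) \<and>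
    (\<forall>p q s. root_value s a b (p * \<alpha>) (q * \<beta>)
       + root_value s a b (p * (?Fa z (\<lambda>_. 1) - \<alpha>)) (q * (?Fb z (\<lambda>_. 1) - \<beta>))
       \<le> V (m + s) (Suc n) (\<lambda>g. p * ?Fa z g - q * ?Fb z g)))"
  have "\<forall>z. \<exists>t. test z t"
    using Suc.IH[OF lins carr] by (simp add: test_def)
  then obtain t where t: "\<And>z. test z (t z)"
    by (rule choice[THEN exE]) blast
  define \<alpha> \<beta> where "\<alpha> = (\<lambda>z. fst (t z))" and "\<beta> = (\<lambda>z. snd (t z))"
  have ab: "2 * (\<alpha> z - \<beta> z) = V m (Suc n) (\<lambda>g. ?Fa z g - ?Fb z g) + ?Fa z (\<lambda>_. 1) - ?Fb z (\<lambda>_. 1)"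
    and rv: "root_value s a b (p * \<alpha> z) (q * \<beta> z)
       + root_value s a b (p * (?Fa z (\<lambda>_. 1) - \<alpha> z)) (q * (?Fb z (\<lambda>_. 1) - \<beta> z))
       \<le> V (m + s) (Suc n) (\<lambda>g. p * ?Fa z g - q * ?Fb z g)" for z p q s
    using t[of z] by (simp_all add: test_def \<alpha>_def \<beta>_def split_beta)
  have one: "(\<Sum>z\<in>Sg. ?Fa z (\<lambda>_. 1)) = Fa (\<lambda>_. 1)" "(\<Sum>z\<in>Sg. ?Fb z (\<lambda>_. 1)) = Fb (\<lambda>_. 1)"
    using Suc.prems by (simp_all add: sum_step sample_def E_one)
  \<comment> \<open>\<open>u\<close> is optimal for equal weights, yet the same query serves all
    weights \<open>p\<close> and \<open>q\<close>.\<close>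
  have steq: "step u n z (\<lambda>g. p * Fa g - q * Fb g) = (\<lambda>g. p * ?Fa z g - q * ?Fb z g)" for z p q
    by (simp add: step_apply fun_eq_iff)
  have "2 * ((\<Sum>z\<in>Sg. \<alpha> z) - (\<Sum>z\<in>Sg. \<beta> z)) = (\<Sum>z\<in>Sg. 2 * (\<alpha> z - \<beta> z))"
    by (simp add: sum_subtractf sum_distrib_left)
  also have "\<dots> = V (Suc m) n (\<lambda>g. Fa g - Fb g) + Fa (\<lambda>_. 1) - Fb (\<lambda>_. 1)"
    unfolding ab eq one[symmetric] using steq[of _ 1 1] by (simp add: sum_subtractf sum.distrib)
  finally have 1: "2 * ((\<Sum>z\<in>Sg. \<alpha> z) - (\<Sum>z\<in>Sg. \<beta> z)) = \<dots>" .
  have 2: "root_value s a b (p * (\<Sum>z\<in>Sg. \<alpha> z)) (q * (\<Sum>z\<in>Sg. \<beta> z))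
       + root_value s a b (p * (Fa (\<lambda>_. 1) - (\<Sum>z\<in>Sg. \<alpha> z))) (q * (Fb (\<lambda>_. 1) - (\<Sum>z\<in>Sg. \<beta> z)))
       \<le> V (Suc m + s) n (\<lambda>g. p * Fa g - q * Fb g)" for p q s
  proof -
    have "root_value s a b (p * (\<Sum>z\<in>Sg. \<alpha> z)) (q * (\<Sum>z\<in>Sg. \<beta> z))
       + root_value s a b (p * (Fa (\<lambda>_. 1) - (\<Sum>z\<in>Sg. \<alpha> z))) (q * (Fb (\<lambda>_. 1) - (\<Sum>z\<in>Sg. \<beta> z)))
      \<le> (\<Sum>z\<in>Sg. root_value s a b (p * \<alpha> z) (q * \<beta> z))
       + (\<Sum>z\<in>Sg. root_value s a b (p * (?Fa z (\<lambda>_. 1) - \<alpha> z)) (q * (?Fb z (\<lambda>_. 1) - \<beta> z)))"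
      unfolding one[symmetric] sum_subtractf[symmetric] sum_distrib_left
      by (intro add_mono root_value_sum finite_Sg)
    also have "\<dots> \<le> (\<Sum>z\<in>Sg. V (m + s) (Suc n) (\<lambda>g. p * ?Fa z g - q * ?Fb z g))"
      unfolding sum.distrib[symmetric] by (intro sum_mono rv)
    also have "\<dots> \<le> V (Suc m + s) n (\<lambda>g. p * Fa g - q * Fb g)"
      unfolding steq[symmetric] add_Suc by (rule V_ge_query[OF u])
    finally show ?thesis .
  qed
  show ?case using 1 2 by blast
qed

text \<open>For probabilities \<alpha> and \<beta>, the right-hand side is twice the total variation
  distance between the numbers of acceptances in three independent runs of a test. Since the
  differences sum to 0, it is at least twice the advantage of any decision rule based on the
  runs.\<close>

lemma amplification_arith:
  fixes \<alpha> \<beta> :: real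
  assumes "\<alpha> - \<beta> \<ge> 1/3"
  defines "A \<equiv> 1 - \<alpha>" and "B \<equiv> 1 - \<beta>"
  defines "X \<equiv> \<alpha>*\<alpha>*\<alpha> - \<beta>*\<beta>*\<beta>" and "Y \<equiv> \<alpha>*\<alpha>*A - \<beta>*\<beta>*B"
    and "Z \<equiv> \<alpha>*A*A - \<beta>*B*B" and "W \<equiv> A*A*A - B*B*B"
  shows "4/5 \<le> \<bar>X\<bar> + 3 * \<bar>Y\<bar> + 3 * \<bar>Z\<bar> + \<bar>W\<bar>" (is "_ \<le> ?R")
proof -
  define d s where "d = \<alpha> - \<beta>" and "s = \<alpha> + \<beta>"
  have d: "d \<ge> 1/3" using assms(1) by (simp add: d_def)
  note defs = X_def Y_def Z_def W_def A_def B_def d_def s_def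
  \<comment> \<open>After the vanishing total these are the advantages of four rules: one run
    accepts, two runs both accept, two runs do not both reject, and (doubled) the majority of three
    accepts.\<close>
  have sum: "X + 3 * Y + 3 * Z + W = 0" and "X + 2 * Y + Z = d" and "X + Y = d * s"
    and "W + Z = - (d * (2 - s))" and "2 * (X + 3 * Y) = d * (6 * s - 3 * s\<^sup>2 - d\<^sup>2)"
    unfolding defs by (simp_all add: algebra_simps power2_eq_square power3_eq_cube)
  moreover have "2 * (X + 3 * Y) \<le> ?R" using sum by (smt (verit))
  ultimately have R1: "2 * d \<le> ?R" and R2: "2 * (d * s) \<le> ?R" and R3: "2 * (d * (2 - s)) \<le> ?R"
    and R4: "d * (6 * s - 3 * s\<^sup>2 - d\<^sup>2) \<le> ?R"
    by (linarith, linarith, linarith, simp only:)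
  \<comment> \<open>A single run suffices for large \<open>d\<close>. Otherwise \<open>s\<close>
    decides: near 1 the majority is good, because its factor equals
    \<open>3 - 3 * (s - 1)^2 - d^2\<close>; away from 1 one of the two-run rules is good.\<close>
  consider "d \<ge> 2/5" | "s \<ge> 6/5" | "s \<le> 4/5" | "d < 2/5" "4/5 < s" "s < 6/5" by linarith
  then show ?thesis
  proof cases
    case 1 with R1 show ?thesis by linarith
  next
    case 2
    then have "2 * ((1/3) * (6/5)) \<le> 2 * (d * s)" using d by (intro mult_left_mono mult_mono) auto
    with R2 show ?thesis by linarith
  next
    case 3
    then have "2 * ((1/3) * (6/5)) \<le> 2 * (d * (2 - s))" using d by (intro mult_left_mono mult_mono) auto
    with R3 show ?thesis by linarith
  next
    case 4
    have "\<bar>s - 1\<bar> \<le> 1/5" using 4 by linarith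
    then have "(s - 1)\<^sup>2 \<le> (1/5)\<^sup>2" using abs_le_square_iff[of "s - 1" "1/5"] by simp
    moreover have "d\<^sup>2 \<le> (2/5)\<^sup>2" using 4 d by (intro power_mono) auto
    ultimately have "12/5 \<le> 6 * s - 3 * s\<^sup>2 - d\<^sup>2" by (simp add: power2_eq_square algebra_simps)
    then have "1/3 * (12/5) \<le> d * (6 * s - 3 * s\<^sup>2 - d\<^sup>2)" using d by (intro mult_mono) auto
    with R4 show ?thesis by linarith
  qed
qed

text \<open>The test is run three times, each time from the root with the weights left by the
  previous outcomes. Without queries the value is the distance of the weights, so the eight outcomes
  contribute the differences of products; outcomes with equally many acceptances coincide, whence
  the coefficients 3.\<close>

lemma amplification:
  assumes "root_value m a b 1 1 \<ge> 2/3"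
  shows "root_value (3 * m) a b 1 1 \<ge> 4/5"
proof -
  have cc: "carried (\<lambda>g. g (\<lambda>_. x)) (\<lambda>c. c 0 = x)" for x :: 'a
    by (auto simp: carried_def)
  obtain \<alpha> \<beta> where ab: "2 * (\<alpha> - \<beta>) = root_value m a b 1 1" and
    rv: "\<And>p q s. root_value s a b (p * \<alpha>) (q * \<beta>) + root_value s a b (p * (1 - \<alpha>)) (q * (1 - \<beta>))
       \<le> root_value (m + s) a b p q"
    using split_by_test[OF lin_eval lin_eval cc cc, of 1 m a b] unfolding root_value_def by auto
  have r0: "root_value 0 a b p q = \<bar>p - q\<bar>" for p q by (simp add: root_value_def)
  let ?A = "1 - \<alpha>" and ?B = "1 - \<beta>"
  have 1: "\<bar>p * \<alpha> - q * \<beta>\<bar> + \<bar>p * ?A - q * ?B\<bar> \<le> root_value m a b p q" for p q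
    using rv[of 0 p q] by (simp add: r0)
  have 2: "\<bar>p * \<alpha> * \<alpha> - q * \<beta> * \<beta>\<bar> + \<bar>p * \<alpha> * ?A - q * \<beta> * ?B\<bar>
      + (\<bar>p * ?A * \<alpha> - q * ?B * \<beta>\<bar> + \<bar>p * ?A * ?A - q * ?B * ?B\<bar>) \<le> root_value (m + m) a b p q" for p q
    using 1[of "p * \<alpha>" "q * \<beta>"] 1[of "p * ?A" "q * ?B"] rv[of m p q] by linarith
  have "\<alpha> - \<beta> \<ge> 1/3" using ab assms by simp
  note amplification_arith[OF this]
  also have "\<bar>\<alpha>*\<alpha>*\<alpha> - \<beta>*\<beta>*\<beta>\<bar> + 3 * \<bar>\<alpha>*\<alpha>*?A - \<beta>*\<beta>*?B\<bar> + 3 * \<bar>\<alpha>*?A*?A - \<beta>*?B*?B\<bar> + \<bar>?A*?A*?A - ?B*?B*?B\<bar>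
      \<le> root_value (m + m) a b \<alpha> \<beta> + root_value (m + m) a b ?A ?B"
    using 2[of \<alpha> \<beta>] 2[of ?A ?B]
    unfolding mult.commute[of ?A \<alpha>] mult.commute[of ?B \<beta>]
      mult.assoc mult.left_commute[of ?A \<alpha>] mult.left_commute[of ?B \<beta>] by linarith
  also have "\<dots> \<le> root_value (m + (m + m)) a b 1 1"
    using rv[of "m + m" 1 1] by simp
  finally show ?thesis by (simp add: numeral_3_eq_3 add_ac)
qed

lemma full_value_same_obs:
  assumes "ob a = ob b" "ob b \<in> Sg" shows "full_value m a b = root_value m a b 1 1"
proof -
  have "reveal 0 z (\<lambda>g. g (\<lambda>_. a) - g (\<lambda>_. b)) = (if ob b = z then (\<lambda>g. g (\<lambda>_. a) - g (\<lambda>_. b)) else (\<lambda>_. 0))" for z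
    using assms by (auto simp: reveal_def fun_eq_iff)
  then have "V m 1 (reveal 0 z (\<lambda>g. g (\<lambda>_. a) - g (\<lambda>_. b))) = (if ob b = z then root_value m a b 1 1 else 0)" for z
    by (simp add: root_value_def V_zero)
  then show ?thesis
    using assms finite_Sg by (simp add: full_value_def)
qed

lemma full_value_mono: "m \<le> m' \<Longrightarrow> full_value m a b \<le> full_value m' a b"
  unfolding full_value_def
  by (intro sum_mono V_mono lin_reveal) (auto simp: lin_def algebra_simps)

lemma full_value_different_obs:
  assumes "ob a \<noteq> ob b" "ob a \<in> Sg" "ob b \<in> Sg" shows "full_value m a b \<ge> 2"
proof -
  have "V 0 1 (reveal 0 z (\<lambda>g. g (\<lambda>_. a) - g (\<lambda>_. b))) = (if ob a = z then 1 else 0) + (if ob b = z then 1 else 0)" for z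
    using assms(1) by (auto simp: reveal_def)
  then have "full_value 0 a b = 2"
    using assms finite_Sg by (simp add: full_value_def sum.distrib)
  then show ?thesis using full_value_mono[of 0 m a b] by simp
qed

lemma full_value_amplification:
  assumes "full_value m a b \<ge> 2/3" "ob a \<in> Sg" "ob b \<in> Sg"
  shows "full_value (3 * m) a b \<ge> 4/5"
proof (cases "ob a = ob b")
  case True
  with assms amplification[of m a b] show ?thesis by (simp only: full_value_same_obs)
next
  case False
  from full_value_different_obs[OF this assms(2,3), of "3 * m"] show ?thesis by simp
qed

end

section \<open>The encoded chain reveals little\<close>

text \<open>\<open>k\<close> is the number of moves along a path, and \<open>r\<close> numbers the
  observations to fix the countdown lengths. \<open>E_swap\<close> is Fubini's theorem, which lets
  independent samples be reordered.\<close>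

locale encoded_chain = M: query_system E ob Sg
  for E :: "'a \<Rightarrow> ('a \<Rightarrow> real) \<Rightarrow> real" and ob :: "'a \<Rightarrow> 'o" and Sg :: "'o set" +
  fixes k :: nat and r :: "'o \<Rightarrow> nat"
  assumes E_swap: "E x (\<lambda>y. E x' (g y)) = E x' (\<lambda>y'. E x (\<lambda>y. g y y'))"
    and r_inj: "inj_on r Sg" and r_less: "z \<in> Sg \<Longrightarrow> r z < k"
begin

text \<open>
  A state \<open>x\<close> becomes a path \<open>Inl (x, 0), \<dots>, Inl (x, k)\<close>. At its end a fair coin decides between
  starting the path of a successor of \<open>x\<close> and a countdown \<open>Inr (Suc (r (ob x))), \<dots>, Inr 0\<close> to the
  sink, whose duration reveals \<open>ob x\<close>.
\<close>

definition Eh :: "('a \<times> nat) + nat \<Rightarrow> (('a \<times> nat) + nat \<Rightarrow> real) \<Rightarrow> real" where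
  "Eh x g = (case x of
     Inl (x, j) \<Rightarrow> if j < k then g (Inl (x, Suc j))
                   else (g (Inr (Suc (r (ob x)))) + E x (\<lambda>y. g (Inl (y, 0)))) / 2
   | Inr j \<Rightarrow> g (Inr (j - 1)))"

definition obh :: "('a \<times> nat) + nat \<Rightarrow> nat" where
  "obh x = (if x = Inr 0 then 1 else 0)"

lemma Eh_simps:
  "j < k \<Longrightarrow> Eh (Inl (x, j)) g = g (Inl (x, Suc j))"
  "Eh (Inl (x, k)) g = (g (Inr (Suc (r (ob x)))) + E x (\<lambda>y. g (Inl (y, 0)))) / 2"
  "Eh (Inr j) g = g (Inr (j - 1))"
  by (simp_all add: Eh_def)

lemma obh_simps [simp]: "obh (Inl xj) = 0" "obh (Inr (Suc j)) = 0" "obh (Inr 0) = 1"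
  by (simp_all add: obh_def)

sublocale H: query_system Eh obh "{0, 1}"
proof
  show "Eh x g = Eh x h" if "\<And>y. obh y \<in> {0, 1} \<Longrightarrow> g y = h y" for x g h
    using that by (auto simp: obh_def intro!: arg_cong[where f="Eh x"])
qed (auto simp: Eh_def M.E_add M.E_scale M.E_one algebra_simps add_divide_distrib split: sum.split)

section \<open>Encoded tuples as labels on hidden states\<close>

definition place :: "(nat \<Rightarrow> 'a) \<Rightarrow> (nat \<times> nat) + nat \<Rightarrow> ('a \<times> nat) + nat" where
  "place c x = (case x of Inl (p, j) \<Rightarrow> Inl (c p, j) | Inr j \<Rightarrow> Inr j)"

lemma place_simps [simp]: "place c (Inl (p, j)) = Inl (c p, j)" "place c (Inr j) = Inr j"
  by (simp_all add: place_def)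

text \<open>All randomness sits in the law \<open>F\<close> of the hidden states, while labels are
  deterministic: \<open>Inl (p, j)\<close> is position \<open>j\<close> on the path of hidden
  coordinate \<open>p\<close>, and \<open>Inr j\<close> is a countdown value. Several slots may
  refer to one hidden coordinate.\<close>

definition lift :: "(nat \<Rightarrow> (nat \<times> nat) + nat) \<Rightarrow> 'a functional \<Rightarrow> (('a \<times> nat) + nat) functional" where
  "lift lab F = (\<lambda>g. F (\<lambda>c. g (\<lambda>h. place c (lab h))))"

lemma lift_apply: "lift lab F g = F (\<lambda>c. g (\<lambda>h. place c (lab h)))"
  by (simp add: lift_def)

lemma lin_lift: "lin F \<Longrightarrow> lin (lift lab F)"
  unfolding lift_def by (rule lin_pull)

lemma place_upd: "(\<lambda>h. place c (lab h))(n := place c x) = (\<lambda>h. place c ((lab(n := x)) h))"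
  by auto

lemma step_lift:
  "H.step h n z (lift lab F) g
   = F (\<lambda>c. Eh (place c (lab h)) (\<lambda>y. if obh y = z then g ((\<lambda>h. place c (lab h))(n := y)) else 0))"
  by (simp add: H.step_apply lift_def)

lemma step_lift_path:
  assumes "lab h = Inl (p, j)" "j < k" "lin F"
  shows "H.step h n z (lift lab F) = (if z = 0 then lift (lab(n := Inl (p, Suc j))) F else (\<lambda>g. 0))"
  using assms
  by (intro ext) (simp add: step_lift Eh_simps lin_zero lift_apply place_upd[of _ lab n "Inl (p, Suc j)", simplified])

lemma step_lift_countdown:
  assumes "lab h = Inr j" "lin F"
  shows "H.step h n z (lift lab F)
    = (if z = (if j \<le> 1 then 1 else 0) then lift (lab(n := Inr (j - 1))) F else (\<lambda>g. 0))"
  using assms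
  by (intro ext)
    (auto simp: step_lift Eh_simps lin_zero lift_apply obh_def place_upd[of _ lab n "Inr (j - 1)", simplified])

text \<open>Both sides of the coin are observed as 0, so the query leaves a mixture of two lifted
  laws. Knowing \<open>w\<close> keeps the countdown label deterministic, and the fresh coordinate
  \<open>q\<close> receives the successor.\<close>

lemma step_lift_coin:
  assumes h: "lab h = Inl (p, k)" and F: "lin F"
    and q: "\<And>h j. lab h \<noteq> Inl (q, j)" and w: "carried F (\<lambda>c. ob (c p) = w)"
  shows "H.step h n z (lift lab F) = (if z = 0 then
      (\<lambda>g. 1/2 * lift (lab(n := Inr (Suc (r w)))) F g + 1/2 * lift (lab(n := Inl (q, 0))) (M.sample p q F) g)
      else (\<lambda>g. 0))"
proof (rule ext)
  fix g
  have 0: "H.step h n z (lift lab F) g = 0" if "z \<noteq> 0"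
    using that by (simp add: step_lift h Eh_simps M.E_const lin_zero F)
  have 1: "H.step h n 0 (lift lab F) g = F (\<lambda>c.
      1/2 * g ((\<lambda>h. place c (lab h))(n := Inr (Suc (r (ob (c p)))))) +
      1/2 * E (c p) (\<lambda>y. g ((\<lambda>h. place c (lab h))(n := Inl (y, 0)))))"
    by (simp add: step_lift h Eh_simps add_divide_distrib)
  have 2: "(\<lambda>h. place (c(q := y)) ((lab(n := Inl (q, 0))) h)) = (\<lambda>h. place c (lab h))(n := Inl (y, 0))"
    for c y
    using q by (auto simp: fun_eq_iff place_def split: sum.split)
  have 3: "F (\<lambda>c. 1/2 * g ((\<lambda>h. place c (lab h))(n := Inr (Suc (r (ob (c p)))))) +
      1/2 * E (c p) (\<lambda>y. g ((\<lambda>h. place c (lab h))(n := Inl (y, 0)))))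
    = F (\<lambda>c. 1/2 * g (\<lambda>h. place c ((lab(n := Inr (Suc (r w)))) h)) +
      1/2 * E (c p) (\<lambda>y. g (\<lambda>h. place (c(q := y)) ((lab(n := Inl (q, 0))) h))))"
    unfolding 2 place_upd[symmetric] by (rule carriedD[OF w]) simp
  have "H.step h n 0 (lift lab F) g
      = 1/2 * lift (lab(n := Inr (Suc (r w)))) F g + 1/2 * lift (lab(n := Inl (q, 0))) (M.sample p q F) g"
    unfolding 1 3 lin_add[OF F] lin_scale[OF F] lift_apply M.sample_def ..
  with 0 show "H.step h n z (lift lab F) g = (if z = 0 then
      (\<lambda>g. 1/2 * lift (lab(n := Inr (Suc (r w)))) F g + 1/2 * lift (lab(n := Inl (q, 0))) (M.sample p q F) g)
      else (\<lambda>g. 0)) g"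
    by simp
qed

text \<open>Lazy sampling: a pair \<open>(p, u)\<close> stands for a successor \<open>p\<close> of
  \<open>u\<close> whose observation has not been used yet. The newest pair is the head and is
  sampled last.\<close>

fun pend :: "(nat \<times> nat) list \<Rightarrow> 'a functional \<Rightarrow> 'a functional" where
  "pend [] F = F"
| "pend ((p, u) # L) F = M.sample u p (pend L F)"

lemma lin_pend: "lin F \<Longrightarrow> lin (pend L F)"
  by (induction L) (auto simp: M.lin_sample)

lemma pend_sum: "pend L (\<lambda>g. \<Sum>i\<in>I. F i g) = (\<lambda>g. \<Sum>i\<in>I. pend L (F i) g)"
  by (induction L) (auto simp: M.sample_def)

lemma carried_pend:
  assumes "carried F (\<lambda>c. \<forall>p\<in>A. ob (c p) = kn p)" "fst ` set L \<inter> A = {}"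
  shows "carried (pend L F) (\<lambda>c. \<forall>p\<in>A. ob (c p) = kn p)"
  using assms(2)
proof (induction L)
  case (Cons pu L)
  obtain p u where pu: "pu = (p, u)" by (cases pu)
  with Cons show ?case by (auto intro!: M.carried_sample)
qed (simp add: assms(1))

text \<open>Fubini applies because neither sample overwrites the other or the parent of the
  other.\<close>

lemma sample_commute:
  assumes "p \<noteq> q" "p \<noteq> v" "q \<noteq> u"
  shows "M.sample u p (M.sample v q F) = M.sample v q (M.sample u p F)"
proof (rule ext)
  fix g
  have "E (c v) (\<lambda>y. E (c u) (\<lambda>y'. g (c(q := y, p := y'))))
      = E (c u) (\<lambda>y'. E (c v) (\<lambda>y. g (c(p := y', q := y))))" for c
    unfolding fun_upd_twist[OF assms(1)] by (rule E_swap)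
  then show "M.sample u p (M.sample v q F) g = M.sample v q (M.sample u p F) g"
    using assms by (simp add: M.sample_def)
qed

text \<open>A pending sample that is no parent of another one, and whose own parent is not pending,
  may be drawn before all others.\<close>

lemma pend_remove:
  assumes "distinct (map fst (L1 @ (p, u) # L2))" "p \<notin> snd ` set (L1 @ L2)" "u \<notin> fst ` set (L1 @ L2)"
  shows "pend (L1 @ (p, u) # L2) F = pend (L1 @ L2) (M.sample u p F)"
proof -
  have comm: "M.sample u p (pend L F) = pend L (M.sample u p F)"
    if "p \<notin> fst ` set L" "p \<notin> snd ` set L" "u \<notin> fst ` set L" for L
    using that
  proof (induction L)
    case (Cons qv L)
    obtain q v where "qv = (q, v)" by (cases qv)
    with Cons show ?case using sample_commute[of p q v u "pend L F"] by auto
  qed simp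
  from assms show ?thesis
  proof (induction L1)
    case Nil
    then show ?case using comm[of L2] by auto
  next
    case (Cons qv L1)
    then show ?case by (cases qv) auto
  qed
qed

text \<open>The images under \<open>\<pi>\<close> of the indices below \<open>n\<close> are the
  active coordinates, with observations known to be \<open>kn\<close>; those in \<open>L\<close> are
  pending and have active parents. All lie below the number \<open>H\<close> of encoded slots, so
  \<open>H\<close> is a fresh name. Every value of \<open>\<pi>\<close> is active, which keeps
  \<open>c \<circ> \<pi>\<close> independent of pending coordinates.\<close>

definition frame ::
    "nat \<Rightarrow> (nat \<times> nat) list \<Rightarrow> nat \<Rightarrow> (nat \<Rightarrow> nat) \<Rightarrow> (nat \<Rightarrow> 'o) \<Rightarrow> 'a functional \<Rightarrow> bool" where
  "frame H L n \<pi> kn F \<longleftrightarrow>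
     lin F \<and> 0 < n \<and> 0 < H \<and> (\<forall>i. \<pi> i \<in> \<pi> ` {..<n}) \<and>
     distinct (map fst L) \<and> fst ` set L \<inter> \<pi> ` {..<n} = {} \<and> snd ` set L \<subseteq> \<pi> ` {..<n} \<and>
     fst ` set L \<union> \<pi> ` {..<n} \<subseteq> {..<H} \<and>
     carried F (\<lambda>c. \<forall>p\<in>\<pi> ` {..<n}. ob (c p) = kn p)"

text \<open>\<open>mx p\<close> bounds the progress made on the path of a pending \<open>p\<close>;
  slots on paths of active coordinates may be anywhere.\<close>

definition labels ::
    "(nat \<Rightarrow> (nat \<times> nat) + nat) \<Rightarrow> (nat \<Rightarrow> nat) \<Rightarrow> nat set \<Rightarrow> nat set \<Rightarrow> bool" where
  "labels lab mx P A \<longleftrightarrow>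
     (\<forall>h p j. lab h = Inl (p, j) \<longrightarrow> j \<le> k \<and> (p \<in> A \<or> p \<in> P \<and> j \<le> mx p))"

lemma frame_lin: "frame H L n \<pi> kn F \<Longrightarrow> lin F"
  and frame_pos: "frame H L n \<pi> kn F \<Longrightarrow> 0 < n" "frame H L n \<pi> kn F \<Longrightarrow> 0 < H"
  by (simp_all add: frame_def)

lemma frame_Suc: "frame H L n \<pi> kn F \<Longrightarrow> frame (Suc H) L n \<pi> kn F"
  by (auto simp: frame_def)

lemma frame_cons:
  assumes "frame H L n \<pi> kn F" "p \<in> \<pi> ` {..<n}"
  shows "frame (Suc H) ((H, p) # L) n \<pi> kn F"
proof -
  have "H \<notin> fst ` set L" "H \<notin> \<pi> ` {..<n}"
    using assms by (auto simp: frame_def)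
  then show ?thesis using assms by (auto simp: frame_def)
qed

lemma frame_activate:
  assumes "frame H (L1 @ (p, u) # L2) n \<pi> kn F"
  shows "frame H (L1 @ L2) (Suc n) (\<pi>(n := p)) (kn(p := z)) (M.step u p z F)"
proof -
  have p: "p \<notin> \<pi> ` {..<n}" using assms by (auto simp: frame_def)
  have \<pi>: "(\<pi>(n := p)) ` {..<Suc n} = insert p (\<pi> ` {..<n})"
    by (auto simp: lessThan_Suc)
  have "carried (M.step u p z F) (\<lambda>c. (\<forall>q\<in>\<pi> ` {..<n}. ob (c q) = kn q) \<and> ob (c p) = z)"
    using assms p by (intro M.carried_step) (auto simp: frame_def)
  then have "carried (M.step u p z F) (\<lambda>c. \<forall>q\<in>insert p (\<pi> ` {..<n}). ob (c q) = (kn(p := z)) q)"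
    using p by (auto elim!: M.carried_weaken)
  moreover have "p \<notin> fst ` set (L1 @ L2)" "distinct (map fst (L1 @ L2))"
    using assms by (auto simp: frame_def)
  moreover have "\<forall>i. (\<pi>(n := p)) i \<in> insert p (\<pi> ` {..<n})"
    using assms by (auto simp: frame_def)
  ultimately show ?thesis
    using assms unfolding frame_def \<pi> by (auto simp: M.lin_step)
qed

lemma labels_upd:
  assumes "labels lab mx P A" "P \<subseteq> P'" "\<And>q. q \<in> P \<Longrightarrow> mx q \<le> mx' q"
    and "\<And>p j. x = Inl (p, j) \<Longrightarrow> j \<le> k \<and> (p \<in> A \<or> p \<in> P' \<and> j \<le> mx' p)"
  shows "labels (lab(n := x)) mx' P' A"
  unfolding labels_def
proof (intro allI impI)
  fix h p j assume *: "(lab(n := x)) h = Inl (p, j)"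
  show "j \<le> k \<and> (p \<in> A \<or> p \<in> P' \<and> j \<le> mx' p)"
  proof (cases "h = n")
    case True
    with * assms(4) show ?thesis by simp
  next
    case False
    with * assms(1) have "j \<le> k \<and> (p \<in> A \<or> p \<in> P \<and> j \<le> mx p)" by (auto simp: labels_def)
    with assms(2) assms(3)[of p] show ?thesis by auto
  qed
qed

lemma sum_fun_upd_le_Suc:
  fixes f :: "'c \<Rightarrow> nat"
  assumes "finite S" "p \<in> S \<Longrightarrow> a \<le> Suc (f p)"
  shows "sum (f(p := a)) S \<le> Suc (sum f S)"
proof (cases "p \<in> S")
  case True
  then have "sum (f(p := a)) S = a + sum (f(p := a)) (S - {p})" "sum f S = f p + sum f (S - {p})"
    using assms(1) by (simp_all add: sum.remove)
  moreover have "sum (f(p := a)) (S - {p}) = sum f (S - {p})" by (rule sum.cong) auto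
  ultimately show ?thesis using assms(2)[OF True] by simp
next
  case False
  then have "sum (f(p := a)) S = sum f S" by (intro sum.cong) auto
  then show ?thesis by simp
qed

section \<open>The simulation invariant and the effect of one query\<close>

definition query_value where
  "query_value T n h F = (\<Sum>z\<in>{0, 1}. H.V T (Suc n) (H.step h n z F))"

lemma query_value_lift_path:
  assumes "lab h = Inl (p, j)" "j < k" "lin F"
  shows "query_value T n h (lift lab F) = H.V T (Suc n) (lift (lab(n := Inl (p, Suc j))) F)"
  using assms by (simp add: query_value_def step_lift_path H.V_zero del: One_nat_def)

lemma query_value_lift_countdown:
  assumes "lab h = Inr j" "lin F"
  shows "query_value T n h (lift lab F) = H.V T (Suc n) (lift (lab(n := Inr (j - 1))) F)"
  using assms by (simp add: query_value_def step_lift_countdown H.V_zero del: One_nat_def)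

lemma query_value_lift_coin:
  assumes "lab h = Inl (p, k)" "lin F" "\<And>h j. lab h \<noteq> Inl (q, j)" "carried F (\<lambda>c. ob (c p) = w)"
  shows "query_value T n h (lift lab F) \<le> 1/2 * H.V T (Suc n) (lift (lab(n := Inr (Suc (r w)))) F)
    + 1/2 * H.V T (Suc n) (lift (lab(n := Inl (q, 0))) (M.sample p q F))"
proof -
  have "query_value T n h (lift lab F) = H.V T (Suc n)
      (\<lambda>g. 1/2 * lift (lab(n := Inr (Suc (r w)))) F g + 1/2 * lift (lab(n := Inl (q, 0))) (M.sample p q F) g)"
    unfolding query_value_def step_lift_coin[where lab=lab and h=h and p=p and q=q and w=w, OF assms]
    by (simp add: H.V_zero del: One_nat_def)
  also have "\<dots> \<le> H.V T (Suc n) (\<lambda>g. 1/2 * lift (lab(n := Inr (Suc (r w)))) F g)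
     + H.V T (Suc n) (\<lambda>g. 1/2 * lift (lab(n := Inl (q, 0))) (M.sample p q F) g)"
    by (rule H.V_add) simp
  also have "\<dots> = 1/2 * H.V T (Suc n) (lift (lab(n := Inr (Suc (r w)))) F)
    + 1/2 * H.V T (Suc n) (lift (lab(n := Inl (q, 0))) (M.sample p q F))"
    by (subst (1 2) H.V_scale) simp_all
  finally show ?thesis .
qed

lemma query_value_sum:
  "query_value T n h (\<lambda>g. \<Sum>i\<in>I. F i g) \<le> (\<Sum>i\<in>I. query_value T n h (F i))"
proof -
  have *: "H.step h n z (\<lambda>g. \<Sum>i\<in>I. F i g) = (\<lambda>g. \<Sum>i\<in>I. H.step h n z (F i) g)" for z
    by (simp add: H.step_apply fun_eq_iff)
  have "query_value T n h (\<lambda>g. \<Sum>i\<in>I. F i g) \<le> (\<Sum>z\<in>{0, 1}. \<Sum>i\<in>I. H.V T (Suc n) (H.step h n z (F i)))"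
    unfolding query_value_def * by (intro sum_mono H.V_sum) simp
  also have "\<dots> = (\<Sum>i\<in>I. query_value T n h (F i))"
    unfolding query_value_def by (rule sum.swap)
  finally show ?thesis .
qed

text \<open>The inequality is a potential argument: progress on pending paths counts as queries
  already spent, and each of the \<open>m\<close> original queries left is worth
  \<open>k + 1\<close> units.\<close>

definition simulates where
  "simulates T H lab mx L n \<pi> kn F m \<longleftrightarrow>
     frame H L n \<pi> kn F \<and> labels lab mx (fst ` set L) (\<pi> ` {..<n}) \<and>
     T + sum mx (fst ` set L) \<le> Suc k * m"

text \<open>The query consumes one unit of \<open>T\<close> and advances at most one pending path by
  one position, so the budget is preserved with the same \<open>m\<close>.\<close>

lemma query_le_deterministic:
  assumes IH: "\<And>H lab mx L F. simulates T H lab mx L n \<pi> kn F m \<Longrightarrow>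
      H.V T H (lift lab (pend L F)) \<le> M.V m n (\<lambda>g. F (\<lambda>c. g (c \<circ> \<pi>)))"
    and S: "simulates (Suc T) H lab mx L n \<pi> kn F m"
    and h: "\<And>p. lab h \<noteq> Inl (p, k)"
  shows "query_value T H h (lift lab (pend L F)) \<le> M.V m n (\<lambda>g. F (\<lambda>c. g (c \<circ> \<pi>)))"
proof -
  from S have fr: "frame H L n \<pi> kn F" and lab: "labels lab mx (fst ` set L) (\<pi> ` {..<n})"
    and T: "Suc T + sum mx (fst ` set L) \<le> Suc k * m"
    by (simp_all add: simulates_def)
  have F: "lin (pend L F)" using fr by (intro lin_pend frame_lin)
  show ?thesis
  proof (cases "lab h")
    case (Inr j)
    have "simulates T (Suc H) (lab(H := Inr (j - 1))) mx L n \<pi> kn F m"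
      using T unfolding simulates_def by (auto intro: frame_Suc fr labels_upd[OF lab])
    from IH[OF this] show ?thesis by (simp add: query_value_lift_countdown[where lab=lab and h=h, OF Inr F])
  next
    case (Inl pj)
    then obtain p j where pj: "lab h = Inl (p, j)" by (cases pj) simp
    with h lab have jk: "j < k" and p: "p \<in> \<pi> ` {..<n} \<or> p \<in> fst ` set L \<and> j \<le> mx p"
      unfolding labels_def by (metis le_neq_implies_less)+
    let ?mx = "mx(p := max (mx p) (Suc j))"
    have "p \<in> fst ` set L \<Longrightarrow> max (mx p) (Suc j) \<le> Suc (mx p)"
      using fr p by (auto simp: frame_def)
    then have "sum ?mx (fst ` set L) \<le> Suc (sum mx (fst ` set L))"
      by (intro sum_fun_upd_le_Suc) auto
    then have "T + sum ?mx (fst ` set L) \<le> Suc k * m" using T by linarith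
    moreover have "labels (lab(H := Inl (p, Suc j))) ?mx (fst ` set L) (\<pi> ` {..<n})"
      using p jk by (intro labels_upd[OF lab]) auto
    ultimately have "simulates T (Suc H) (lab(H := Inl (p, Suc j))) ?mx L n \<pi> kn F m"
      using fr by (simp add: simulates_def frame_Suc)
    from IH[OF this] show ?thesis by (simp add: query_value_lift_path[where lab=lab and h=h, OF pj jk F])
  qed
qed

text \<open>Neither side of the coin needs an original query: the countdown depends on an
  observation already known, and the successor merely becomes pending with progress 0. The budget is
  assumed for \<open>T\<close> rather than \<open>Suc T\<close>, since in the pending case the query
  itself has been charged elsewhere.\<close>

lemma query_le_coin:
  assumes IH: "\<And>H lab mx L F. simulates T H lab mx L n \<pi> kn F m \<Longrightarrow>
      H.V T H (lift lab (pend L F)) \<le> M.V m n (\<lambda>g. F (\<lambda>c. g (c \<circ> \<pi>)))"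
    and S: "simulates T H lab mx L n \<pi> kn F m"
    and coin: "lab h = Inl (p, k)" and p: "p \<in> \<pi> ` {..<n}"
  shows "query_value T H h (lift lab (pend L F)) \<le> M.V m n (\<lambda>g. F (\<lambda>c. g (c \<circ> \<pi>)))"
proof -
  from S have fr: "frame H L n \<pi> kn F" and lab: "labels lab mx (fst ` set L) (\<pi> ` {..<n})"
    and T: "T + sum mx (fst ` set L) \<le> Suc k * m"
    by (simp_all add: simulates_def)
  have F: "lin (pend L F)" using fr by (intro lin_pend frame_lin)
  let ?L = "(H, p) # L" and ?mx = "mx(H := 0)"
  have new: "H \<notin> fst ` set L" "H \<notin> \<pi> ` {..<n}" using fr by (auto simp: frame_def)
  have fresh: "lab h \<noteq> Inl (H, j)" for h j using lab new by (auto simp: labels_def)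
  have "carried (pend L F) (\<lambda>c. \<forall>p\<in>\<pi> ` {..<n}. ob (c p) = kn p)"
    using fr by (intro carried_pend) (auto simp: frame_def)
  then have w: "carried (pend L F) (\<lambda>c. ob (c p) = kn p)"
    using p by (auto intro: M.carried_weaken)
  have 1: "simulates T (Suc H) (lab(H := Inr (Suc (r (kn p))))) mx L n \<pi> kn F m"
    using T unfolding simulates_def by (auto intro: frame_Suc fr labels_upd[OF lab])
  have "sum ?mx (fst ` set L) = sum mx (fst ` set L)"
    using new by (intro sum.cong) auto
  then have "sum ?mx (fst ` set ?L) = sum mx (fst ` set L)"
    using new by simp
  moreover have "labels (lab(H := Inl (H, 0))) ?mx (fst ` set ?L) (\<pi> ` {..<n})"
    using new by (intro labels_upd[OF lab]) auto
  ultimately have 2: "simulates T (Suc H) (lab(H := Inl (H, 0))) ?mx ?L n \<pi> kn F m"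
    using T frame_cons[OF fr p] by (simp only: simulates_def)
  have "query_value T H h (lift lab (pend L F))
    \<le> 1/2 * H.V T (Suc H) (lift (lab(H := Inr (Suc (r (kn p))))) (pend L F))
      + 1/2 * H.V T (Suc H) (lift (lab(H := Inl (H, 0))) (M.sample p H (pend L F)))"
    by (rule query_value_lift_coin[where lab=lab and h=h and p=p and q=H, OF coin F fresh w])
  also have "\<dots> \<le> M.V m n (\<lambda>g. F (\<lambda>c. g (c \<circ> \<pi>)))"
    using IH[OF 1] IH[OF 2] by simp
  finally show ?thesis .
qed

text \<open>An original query is made only when the end of a pending path is queried. That path has
  then absorbed \<open>k\<close> units and the present query is one more, which pays for it.\<close>

lemma simulation_upper_bound:
  "simulates T H lab mx L n \<pi> kn F m \<Longrightarrow>
    H.V T H (lift lab (pend L F)) \<le> M.V m n (\<lambda>g. F (\<lambda>c. g (c \<circ> \<pi>)))"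
proof (induction T arbitrary: H lab mx L n \<pi> kn F m)
  case 0
  have "pend L F (\<lambda>_. 1) = F (\<lambda>_. 1)"
    by (induction L) (auto simp: M.sample_def M.E_one)
  then have "H.V 0 H (lift lab (pend L F)) = M.V 0 n (\<lambda>g. F (\<lambda>c. g (c \<circ> \<pi>)))"
    by (simp add: lift_apply del: One_nat_def)
  also have "\<dots> \<le> M.V m n (\<lambda>g. F (\<lambda>c. g (c \<circ> \<pi>)))"
  proof (rule M.V_mono)
    have fr: "frame H L n \<pi> kn F" using "0.prems" by (simp add: simulates_def)
    then show "0 < n" by (rule frame_pos)
    show "lin (\<lambda>g. F (\<lambda>c. g (c \<circ> \<pi>)))" by (rule lin_pull[OF frame_lin[OF fr]])
  qed simp
  finally show ?case .
next
  case (Suc T)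
  note S = Suc.prems
  from S have fr: "frame H L n \<pi> kn F" and lab: "labels lab mx (fst ` set L) (\<pi> ` {..<n})"
    and T: "Suc T + sum mx (fst ` set L) \<le> Suc k * m"
    by (simp_all add: simulates_def)
  have lin: "lin F" and "0 < H" using fr by (rule frame_lin, rule frame_pos)
  obtain h where eq: "H.V (Suc T) H (lift lab (pend L F)) = query_value T H h (lift lab (pend L F))"
    unfolding query_value_def by (rule H.V_query_obtain[OF \<open>0 < H\<close>])
  have S0: "simulates T H lab mx L n \<pi> kn F m"
    using fr lab T by (simp add: simulates_def)
  consider (det) "\<And>p. lab h \<noteq> Inl (p, k)"
    | (known) p where "lab h = Inl (p, k)" "p \<in> \<pi> ` {..<n}"
    | (pending) p where "lab h = Inl (p, k)" "p \<notin> \<pi> ` {..<n}" by blast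
  then show ?case
  proof cases
    case det
    show ?thesis unfolding eq by (rule query_le_deterministic[OF Suc.IH S det])
  next
    case known
    show ?thesis unfolding eq by (rule query_le_coin[OF Suc.IH S0 known])
  next
    case pending
    note p = pending
    from lab p have "p \<in> fst ` set L" and k: "k \<le> mx p" by (auto simp: labels_def)
    then obtain u where "(p, u) \<in> set L" by auto
    then obtain L1 L2 where L: "L = L1 @ (p, u) # L2" by (meson split_list)
    let ?L = "L1 @ L2" and ?\<pi> = "\<pi>(n := p)"
    let ?F = "\<lambda>z. M.step u p z F"
    have dist: "distinct (map fst L)" and parents: "snd ` set L \<subseteq> \<pi> ` {..<n}"
      and disj: "fst ` set L \<inter> \<pi> ` {..<n} = {}" and \<pi>i: "\<And>i. \<pi> i \<in> \<pi> ` {..<n}"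
      using fr by (auto simp: frame_def)
    have u: "u \<in> \<pi> ` {..<n}" using parents by (auto simp: L)
    then obtain u' where u': "u' < n" "\<pi> u' = u" by auto
    \<comment> \<open>Only now is \<open>p\<close> drawn, before the other pending samples, and the
      law is split by its observation.\<close>
    have F: "pend L F = (\<lambda>g. \<Sum>z\<in>Sg. pend ?L (?F z) g)"
    proof -
      have "p \<notin> snd ` set ?L" using parents p by (auto simp: L)
      moreover have "u \<notin> fst ` set ?L" using u disj by (auto simp: L)
      ultimately have "pend L F = pend ?L (M.sample u p F)"
        unfolding L by (intro pend_remove dist[unfolded L])
      also have "M.sample u p F = (\<lambda>g. \<Sum>z\<in>Sg. ?F z g)"
        using lin by (simp add: M.sum_step)
      finally show ?thesis by (simp add: pend_sum)
    qed
    have fsetL: "fst ` set L = insert p (fst ` set ?L)" "p \<notin> fst ` set ?L"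
      using dist by (auto simp: L)
    then have "sum mx (fst ` set L) = mx p + sum mx (fst ` set ?L)" by simp
    \<comment> \<open>Removing \<open>p\<close> from the pending list releases at least
      \<open>k\<close> units; together with the current query they amount to one original query, so
      \<open>m\<close> is positive.\<close>
    with T k have "Suc k + (T + sum mx (fst ` set ?L)) \<le> Suc k * m" by linarith
    then obtain m' where m: "m = Suc m'" and m': "T + sum mx (fst ` set ?L) \<le> Suc k * m'"
      by (cases m) auto
    have \<pi>: "?\<pi> ` {..<Suc n} = insert p (\<pi> ` {..<n})" by (auto simp: lessThan_Suc)
    \<comment> \<open>No old index points to the pending \<open>p\<close>, so updating
      \<open>p\<close> acts on the active tuple as appending coordinate \<open>n\<close>.\<close>
    have \<pi>upd: "(c(p := y)) \<circ> ?\<pi> = (c \<circ> \<pi>)(n := y)" for c :: "nat \<Rightarrow> 'a" and y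
    proof
      fix i
      have "\<pi> i \<noteq> p" using \<pi>i p by metis
      then show "((c(p := y)) \<circ> ?\<pi>) i = ((c \<circ> \<pi>)(n := y)) i" by simp
    qed
    have Fz: "(\<lambda>g. ?F z (\<lambda>c. g (c \<circ> ?\<pi>))) = M.step u' n z (\<lambda>g. F (\<lambda>c. g (c \<circ> \<pi>)))" for z
      by (rule ext) (simp only: M.step_apply \<pi>upd comp_apply u'(2))
    have "query_value T H h (lift lab (pend ?L (?F z))) \<le> M.V m' (Suc n) (\<lambda>g. ?F z (\<lambda>c. g (c \<circ> ?\<pi>)))" for z
    proof (rule query_le_coin)
      have "labels lab mx (fst ` set ?L) (?\<pi> ` {..<Suc n})"
        using lab unfolding labels_def \<pi> fsetL(1) by blast
      then show "simulates T H lab mx ?L (Suc n) ?\<pi> (kn(p := z)) (?F z) m'"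
        using m' frame_activate[OF fr[unfolded L]] by (simp only: simulates_def)
      show "lab h = Inl (p, k)" "p \<in> ?\<pi> ` {..<Suc n}" using p \<pi> by auto
    qed (rule Suc.IH)
    then have le: "query_value T H h (lift lab (pend ?L (?F z)))
        \<le> M.V m' (Suc n) (M.step u' n z (\<lambda>g. F (\<lambda>c. g (c \<circ> \<pi>))))" for z
      unfolding Fz .
    have "lift lab (pend L F) = (\<lambda>g. \<Sum>z\<in>Sg. lift lab (pend ?L (?F z)) g)"
      unfolding F lift_def ..
    then have "query_value T H h (lift lab (pend L F))
        \<le> (\<Sum>z\<in>Sg. query_value T H h (lift lab (pend ?L (?F z))))"
      by (simp only: query_value_sum)
    also have "\<dots> \<le> (\<Sum>z\<in>Sg. M.V m' (Suc n) (M.step u' n z (\<lambda>g. F (\<lambda>c. g (c \<circ> \<pi>)))))"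
      by (intro sum_mono le)
    also have "\<dots> \<le> M.V m n (\<lambda>g. F (\<lambda>c. g (c \<circ> \<pi>)))"
      unfolding m by (rule M.V_ge_query[OF u'(1)])
    finally show ?thesis unfolding eq .
  qed
qed

text \<open>No path reaches its coin in time, so every move is deterministic and observed as
  0.\<close>

lemma no_information:
  assumes "lin F" "\<And>h. \<exists>j. lab h = Inl (0, j) \<and> j + T \<le> k" "0 < n"
  shows "H.V T n (lift lab F) = \<bar>F (\<lambda>_. 1)\<bar>"
  using assms(2,3)
proof (induction T arbitrary: n lab)
  case 0
  then show ?case by (simp add: lift_apply del: One_nat_def)
next
  case (Suc T)
  obtain h where eq: "H.V (Suc T) n (lift lab F) = query_value T n h (lift lab F)"
    unfolding query_value_def by (rule H.V_query_obtain[OF \<open>0 < n\<close>])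
  obtain j where j: "lab h = Inl (0, j)" "j < k" "Suc j + T \<le> k"
    using Suc.prems(1)[of h] by auto
  have "\<exists>j'. (lab(n := Inl (0, Suc j))) h' = Inl (0, j') \<and> j' + T \<le> k" for h'
    using Suc.prems(1)[of h'] j by (cases "h' = n") auto
  then have "H.V T (Suc n) (lift (lab(n := Inl (0, Suc j))) F) = \<bar>F (\<lambda>_. 1)\<bar>"
    by (intro Suc.IH) simp_all
  with eq show ?case
    by (simp only: query_value_lift_path[where lab=lab and h=h, OF j(1,2) assms(1)])
qed

definition difference :: "'b \<Rightarrow> 'b \<Rightarrow> 'b functional" where
  "difference a b = (\<lambda>g. g (\<lambda>_. a) - g (\<lambda>_. b))"

lemma lin_difference: "lin (difference a b)"
  unfolding difference_def by (simp add: lin_def algebra_simps)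

lemma full_value_encoded:
  "H.full_value T (Inl (a, 0)) (Inl (b, 0)) = H.V T 1 (lift (\<lambda>_. Inl (0, 0)) (difference a b))"
proof -
  have "H.reveal 0 z (\<lambda>g. g (\<lambda>_. Inl (a, 0)) - g (\<lambda>_. Inl (b, 0)))
      = (if z = 0 then lift (\<lambda>_. Inl (0, 0)) (difference a b) else (\<lambda>g. 0))" for z
    by (auto simp: H.reveal_def lift_def difference_def fun_eq_iff)
  then show ?thesis
    unfolding H.full_value_def by (simp add: H.V_zero del: One_nat_def)
qed

text \<open>The masses of the two initial states cancel. Hence more than \<open>k\<close> queries
  are needed even for states that the original chain separates without a query, which accounts for
  the maximum with 1 in the lower bound.\<close>

lemma full_value_no_information:
  assumes "T \<le> k" shows "H.full_value T (Inl (a, 0)) (Inl (b, 0)) = 0"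
proof -
  have "H.V T 1 (lift (\<lambda>_. Inl (0, 0)) (difference a b)) = \<bar>difference a b (\<lambda>_. 1)\<bar>"
    by (rule no_information[OF lin_difference]) (use assms in auto)
  also have "difference a b (\<lambda>_. 1) = 0" by (simp add: difference_def)
  finally show ?thesis by (simp only: full_value_encoded abs_zero)
qed

text \<open>Giving away the observation of the initial state can only help, by the triangle
  inequality. It makes coordinate 0 active with nothing pending, the starting point of the
  simulation.\<close>

lemma full_value_upper_bound:
  assumes "T \<le> Suc k * m" and ab: "ob a \<in> Sg" "ob b \<in> Sg"
  shows "H.full_value T (Inl (a, 0)) (Inl (b, 0)) \<le> M.full_value m a b"
proof -
  let ?lab = "\<lambda>_. Inl (0, 0)" and ?F = "\<lambda>z. M.reveal 0 z (difference a b)"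
  have "carried (difference a b) (\<lambda>c. ob (c 0) \<in> Sg)"
    using ab by (simp add: carried_def difference_def)
  from M.sum_reveal[OF lin_difference this]
  have "lift ?lab (difference a b) = (\<lambda>g. \<Sum>z\<in>Sg. lift ?lab (?F z) g)"
    by (simp add: lift_def)
  then have "H.V T 1 (lift ?lab (difference a b)) \<le> (\<Sum>z\<in>Sg. H.V T 1 (lift ?lab (?F z)))"
    by (simp only: H.V_sum)
  also have "\<dots> \<le> (\<Sum>z\<in>Sg. M.V m 1 (?F z))"
  proof (rule sum_mono)
    fix z
    have "carried (?F z) (\<lambda>c. True \<and> ob (c 0) = z)"
      by (rule M.carried_reveal) (simp add: carried_def difference_def)
    then have "frame 1 [] 1 (\<lambda>_. 0) (\<lambda>_. z) (?F z)"
      unfolding frame_def by (simp add: M.lin_reveal lin_difference image_constant_conv lessThan_empty_iff lessThan_Suc)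
    moreover have "labels ?lab (\<lambda>_. 0) {} ((\<lambda>_. 0) ` {..<1 :: nat})"
      unfolding labels_def by (simp add: image_constant_conv lessThan_empty_iff lessThan_Suc)
    ultimately have "simulates T 1 ?lab (\<lambda>_. 0) [] 1 (\<lambda>_. 0) (\<lambda>_. z) (?F z) m"
      using assms(1) by (simp add: simulates_def)
    from simulation_upper_bound[OF this]
    have "H.V T 1 (lift ?lab (?F z)) \<le> M.V m 1 (\<lambda>g. ?F z (\<lambda>c. g (c \<circ> (\<lambda>_. 0))))"
      by simp
    also have "(\<lambda>g. ?F z (\<lambda>c. g (c \<circ> (\<lambda>_. 0)))) = ?F z"
      by (simp add: M.reveal_def difference_def o_def)
    finally show "H.V T 1 (lift ?lab (?F z)) \<le> M.V m 1 (?F z)" .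
  qed
  finally show ?thesis
    unfolding full_value_encoded M.full_value_def by (simp add: difference_def)
qed

end

section \<open>The encoded chain reveals enough\<close>

lemma carried_top: "carried F (\<lambda>_. True)"
  unfolding carried_def by (auto intro!: arg_cong[where f=F])

lemma carried_conj:
  assumes "carried F Q" "carried F R" shows "carried F (\<lambda>c. Q c \<and> R c)"
  unfolding carried_def
proof (intro allI impI)
  fix g h :: "(nat \<Rightarrow> 'a) \<Rightarrow> real" assume gh: "\<forall>c. Q c \<and> R c \<longrightarrow> g c = h c"
  \<comment> \<open>The intermediate test function agrees with \<open>g\<close> on \<open>Q\<close>
    and with \<open>h\<close> on \<open>R\<close>.\<close>
  have "F g = F (\<lambda>c. if Q c then g c else h c)"
    by (rule carriedD[OF assms(1)]) simp
  also have "\<dots> = F h"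
    by (rule carriedD[OF assms(2)]) (use gh in auto)
  finally show "F g = F h" .
qed

context query_system
begin

text \<open>Storing the answer in an occupied slot only forgets that slot; reindexing sends
  \<open>v\<close> to the new coordinate.\<close>

lemma V_overwrite:
  assumes "u < n" "v < n"
  shows "(\<Sum>z\<in>Sg. V m n (step u v z F)) \<le> V (Suc m) n F"
proof -
  have "V m n (step u v z F) \<le> V m (Suc n) (step u n z F)" for z
  proof (rule V_reindex)
    fix g :: "(nat \<Rightarrow> 'a) \<Rightarrow> real" assume g: "loc n g"
    have "g (c(v := y)) = g ((c(n := y)) \<circ> id(v := n))" for c y
      by (rule g[unfolded loc_def, rule_format]) (use assms in auto)
    then show "step u v z F g = step u n z F (\<lambda>c. g (c \<circ> id(v := n)))"
      unfolding step_apply by (intro arg_cong[where f=F] ext E_cong) simp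
  qed (use assms in auto)
  then have "(\<Sum>z\<in>Sg. V m n (step u v z F)) \<le> (\<Sum>z\<in>Sg. V m (Suc n) (step u n z F))"
    by (rule sum_mono)
  also have "\<dots> \<le> V (Suc m) n F" by (rule V_ge_query[OF assms(1)])
  finally show ?thesis .
qed

definition observed :: "nat \<Rightarrow> 'a functional \<Rightarrow> bool" where
  "observed n F \<longleftrightarrow> lin F \<and> carried F (\<lambda>c. \<forall>i<n. ob (c i) \<in> Sg)"

lemma observed_reveal:
  assumes "observed n F" shows "observed n (reveal p z F)"
proof -
  have "carried (reveal p z F) (\<lambda>c. (\<forall>i<n. ob (c i) \<in> Sg) \<and> ob (c p) = z)"
    using assms by (intro carried_reveal) (simp add: observed_def)
  then have "carried (reveal p z F) (\<lambda>c. \<forall>i<n. ob (c i) \<in> Sg)"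
    by (rule carried_weaken) simp
  with assms show ?thesis by (simp add: observed_def lin_reveal)
qed

lemma observed_sample:
  assumes "observed n F" shows "observed (Suc n) (sample u n F)"
proof -
  have "carried (sample u n F) (\<lambda>c. \<forall>i<n. ob (c i) \<in> Sg)"
    using assms by (intro carried_sample) (auto simp: observed_def)
  then have "carried (sample u n F) (\<lambda>c. (\<forall>i<n. ob (c i) \<in> Sg) \<and> ob (c n) \<in> Sg)"
    by (intro carried_conj carried_sample_obs)
  then have "carried (sample u n F) (\<lambda>c. \<forall>i<Suc n. ob (c i) \<in> Sg)"
    by (rule carried_weaken) (auto simp: less_Suc_eq)
  with assms show ?thesis by (simp add: observed_def lin_sample)
qed

lemma sum_reveal_observed:
  assumes "observed n F" "p < n" shows "F = (\<lambda>g. \<Sum>z\<in>Sg. reveal p z F g)"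
proof -
  have "carried F (\<lambda>c. ob (c p) \<in> Sg)"
    using assms carried_weaken[of F "\<lambda>c. \<forall>i<n. ob (c i) \<in> Sg"] by (auto simp: observed_def)
  then show ?thesis using assms by (simp add: sum_reveal observed_def)
qed

end

context encoded_chain
begin

section \<open>One round of the reverse simulation\<close>

lemma step_H_sum: "H.step h n z (\<lambda>g. \<Sum>i\<in>I. F i g) = (\<lambda>g. \<Sum>i\<in>I. H.step h n z (F i) g)"
  and step_H_add: "H.step h n z (\<lambda>g. F1 g + F2 g) = (\<lambda>g. H.step h n z F1 g + H.step h n z F2 g)"
  and step_H_scale: "H.step h n z (\<lambda>g. s * F1 g) = (\<lambda>g. s * H.step h n z F1 g)"
  by (simp_all add: H.step_apply fun_eq_iff)

text \<open>The normal form between rounds: each slot in use is at the end of the path of its own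
  hidden coordinate, and \<open>Inr 0\<close> is a filler for the rest.\<close>

definition slots :: "nat \<Rightarrow> nat \<Rightarrow> (nat \<times> nat) + nat" where
  "slots n i = (if i < n then Inl (i, k) else Inr 0)"

lemma slots_Suc: "(slots n)(n := Inl (n, k)) = slots (Suc n)"
  by (auto simp: slots_def fun_eq_iff)

lemma V_lift_cong_le:
  assumes "0 < n" "n \<le> n'" "\<And>i. i < n \<Longrightarrow> lab i = lab' i"
  shows "H.V m n (lift lab F) \<le> H.V m n' (lift lab' F)"
  using assms(1)
proof (rule H.V_reindex)
  fix g :: "(nat \<Rightarrow> ('a \<times> nat) + nat) \<Rightarrow> real" assume g: "loc n g"
  have "g (\<lambda>h. place c (lab h)) = g (\<lambda>h. place c (lab' h))" for c
    by (rule g[unfolded loc_def, rule_format]) (simp add: assms(3))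
  then show "lift lab F g = lift lab' F (\<lambda>c. g (c \<circ> id))"
    by (simp add: lift_apply)
qed (use assms in auto)

lemma V_lift_sample_ge:
  assumes "0 < n"
  shows "H.V m n (lift (slots n) F) \<le> H.V m (Suc n) (lift (slots (Suc n)) (M.sample u n F))"
  using assms
proof (rule H.V_reindex)
  fix g :: "(nat \<Rightarrow> ('a \<times> nat) + nat) \<Rightarrow> real" assume g: "loc n g"
  have "g (\<lambda>h. place (c(n := y)) (slots (Suc n) h)) = g (\<lambda>h. place c (slots n h))" for c y
    by (rule g[unfolded loc_def, rule_format]) (simp add: slots_def)
  then show "lift (slots n) F g = lift (slots (Suc n)) (M.sample u n F) (\<lambda>c. g (c \<circ> id))"
    by (simp add: lift_apply M.sample_def M.E_const)
qed auto

text \<open>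
  The law after a query to the end of the path of \<open>c u\<close> and \<open>t\<close> further moves of the new slot \<open>n\<close>,
  restricted to the event that the sink has not been reached.
\<close>

definition walk :: "nat \<Rightarrow> nat \<Rightarrow> 'a functional \<Rightarrow> nat \<Rightarrow> (('a \<times> nat) + nat) functional" where
  "walk n u F t = (\<lambda>g. (\<Sum>z\<in>{z \<in> Sg. t \<le> r z}. 1/2 * lift ((slots n)(n := Inr (Suc (r z - t)))) (M.reveal u z F) g)
     + 1/2 * lift ((slots n)(n := Inl (n, t))) (M.sample u n F) g)"

lemma walk_0:
  assumes F: "M.observed n F" and u: "u < n"
  shows "H.step u n 0 (lift (slots n) F) = walk n u F 0"
proof -
  have su: "slots n u = Inl (u, k)" and fresh: "slots n h \<noteq> Inl (n, j)" for h j
    using u by (auto simp: slots_def)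
  have F': "lin F" using F by (simp add: M.observed_def)
  have c: "carried (M.reveal u z F) (\<lambda>c. ob (c u) = z)" for z
    using M.carried_reveal[OF carried_top[of F], where p=u and z=z] by simp
  have 1: "H.step u n 0 (lift (slots n) (M.reveal u z F)) =
      (\<lambda>g. 1/2 * lift ((slots n)(n := Inr (Suc (r z)))) (M.reveal u z F) g
         + 1/2 * lift ((slots n)(n := Inl (n, 0))) (M.sample u n (M.reveal u z F)) g)" for z
    using step_lift_coin[where lab="slots n" and h=u and p=u and q=n and n=n and z=0,
        OF su M.lin_reveal[OF F'] fresh c] by simp
  have 2: "F h = (\<Sum>z\<in>Sg. M.reveal u z F h)" for h
    using fun_cong[OF M.sum_reveal_observed[OF F u]] .
  have "lift (slots n) F = (\<lambda>g. \<Sum>z\<in>Sg. lift (slots n) (M.reveal u z F) g)"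
    unfolding lift_def by (rule ext) (rule 2)
  then have 3: "H.step u n 0 (lift (slots n) F) = (\<lambda>g. \<Sum>z\<in>Sg. H.step u n 0 (lift (slots n) (M.reveal u z F)) g)"
    by (simp only: step_H_sum)
  show ?thesis
  proof (rule ext)
    fix g
    have "H.step u n 0 (lift (slots n) F) g
      = (\<Sum>z\<in>Sg. 1/2 * lift ((slots n)(n := Inr (Suc (r z)))) (M.reveal u z F) g)
        + 1/2 * (\<Sum>z\<in>Sg. lift ((slots n)(n := Inl (n, 0))) (M.sample u n (M.reveal u z F)) g)"
      unfolding 3 1 by (simp only: sum.distrib sum_distrib_left)
    also have "(\<Sum>z\<in>Sg. lift ((slots n)(n := Inl (n, 0))) (M.sample u n (M.reveal u z F)) g)
        = lift ((slots n)(n := Inl (n, 0))) (M.sample u n F) g"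
      unfolding lift_apply M.sample_def by (rule 2[symmetric])
    finally show "H.step u n 0 (lift (slots n) F) g = walk n u F 0 g"
      unfolding walk_def by (simp only: le0 simp_thms Collect_mem_eq diff_zero)
  qed
qed

lemma walk_end: "walk n u F k = (\<lambda>g. 1/2 * lift (slots (Suc n)) (M.sample u n F) g)"
proof -
  have "{z \<in> Sg. k \<le> r z} = {}" using r_less by force
  then show ?thesis unfolding walk_def slots_Suc by (simp only: sum.empty add_0)
qed

text \<open>Slot \<open>n\<close> is moved in place. The surviving countdowns have
  \<open>t \<le> r z\<close>; the one with \<open>r z = t\<close> enters the sink next, and the
  answer 1 identifies its observation.\<close>

lemma walk_step:
  assumes F: "lin F" and t: "t < k"
  shows "H.step n n 0 (walk n u F t) = walk n u F (Suc t)"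
    and "H.step n n 1 (walk n u F t)
      = (\<lambda>g. \<Sum>z\<in>{z \<in> Sg. r z = t}. 1/2 * lift ((slots n)(n := Inr 0)) (M.reveal u z F) g)"
proof -
  have 1: "H.step n n w (lift ((slots n)(n := Inr (Suc (r z - t)))) (M.reveal u z F))
    = (if w = (if r z \<le> t then 1 else 0) then lift ((slots n)(n := Inr (r z - t))) (M.reveal u z F) else (\<lambda>g. 0))"
    for z w
    using step_lift_countdown[where lab="(slots n)(n := Inr (Suc (r z - t)))" and h=n and n=n and z=w,
        OF fun_upd_same M.lin_reveal[OF F]] by simp
  have 2: "H.step n n w (lift ((slots n)(n := Inl (n, t))) (M.sample u n F))
    = (if w = 0 then lift ((slots n)(n := Inl (n, Suc t))) (M.sample u n F) else (\<lambda>g. 0))" for w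
    using step_lift_path[where lab="(slots n)(n := Inl (n, t))" and h=n and n=n and z=w,
        OF fun_upd_same t M.lin_sample[OF F]] by simp
  have fin: "finite Sg" by (rule M.finite_Sg)
  have st: "H.step n n w (walk n u F t) g =
      (\<Sum>z\<in>{z \<in> Sg. t \<le> r z}. 1/2 * (if w = (if r z \<le> t then 1 else 0)
         then lift ((slots n)(n := Inr (r z - t))) (M.reveal u z F) g else 0))
      + 1/2 * (if w = 0 then lift ((slots n)(n := Inl (n, Suc t))) (M.sample u n F) g else 0)" for w g
    unfolding walk_def step_H_add step_H_sum step_H_scale 1 2
    by (intro arg_cong2[where f="(+)"] sum.cong) auto
  show "H.step n n 0 (walk n u F t) = walk n u F (Suc t)"
  proof (rule ext)
    fix g
    have "(\<Sum>z\<in>{z \<in> Sg. t \<le> r z}. 1/2 * (if 0 = (if r z \<le> t then 1 else 0 :: nat)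
         then lift ((slots n)(n := Inr (r z - t))) (M.reveal u z F) g else 0))
      = (\<Sum>z\<in>{z \<in> Sg. Suc t \<le> r z}. 1/2 * lift ((slots n)(n := Inr (Suc (r z - Suc t)))) (M.reveal u z F) g)"
      using fin by (intro sum.mono_neutral_cong_right) (auto simp: Suc_diff_Suc)
    then show "H.step n n 0 (walk n u F t) g = walk n u F (Suc t) g"
      unfolding st unfolding walk_def by simp
  qed
  show "H.step n n 1 (walk n u F t)
      = (\<lambda>g. \<Sum>z\<in>{z \<in> Sg. r z = t}. 1/2 * lift ((slots n)(n := Inr 0)) (M.reveal u z F) g)"
  proof (rule ext)
    fix g
    have "(\<Sum>z\<in>{z \<in> Sg. t \<le> r z}. 1/2 * (if 1 = (if r z \<le> t then 1 else 0 :: nat)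
         then lift ((slots n)(n := Inr (r z - t))) (M.reveal u z F) g else 0))
      = (\<Sum>z\<in>{z \<in> Sg. r z = t}. 1/2 * lift ((slots n)(n := Inr 0)) (M.reveal u z F) g)"
      using fin by (intro sum.mono_neutral_cong_right) auto
    then show "H.step n n 1 (walk n u F t) g
      = (\<Sum>z\<in>{z \<in> Sg. r z = t}. 1/2 * lift ((slots n)(n := Inr 0)) (M.reveal u z F) g)"
      unfolding st by simp
  qed
qed

text \<open>When the sink is reached, the observation of \<open>c u\<close> is known, slot
  \<open>n\<close> is dropped and surplus queries are ignored. Otherwise slot \<open>n\<close> ends
  up at the end of the path of a fresh successor.\<close>

lemma walk_value:
  assumes F: "lin F" and n: "0 < n" and "t \<le> k"
  shows "1/2 * (\<Sum>z\<in>{z \<in> Sg. t \<le> r z}. H.V T n (lift (slots n) (M.reveal u z F)))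
      + 1/2 * H.V T (Suc n) (lift (slots (Suc n)) (M.sample u n F))
    \<le> H.V (T + (k - t)) (Suc n) (walk n u F t)"
  using assms(3)
proof (induction "k - t" arbitrary: t)
  case 0
  then have "{z \<in> Sg. t \<le> r z} = {}" "t = k" using r_less by force+
  then show ?case by (simp only: walk_end H.V_scale) simp
next
  case (Suc d)
  then have t: "t < k" by simp
  let ?T = "T + (k - Suc t)" and ?S = "{z \<in> Sg. r z = t}" and ?G = "\<lambda>z. M.reveal u z F"
  \<comment> \<open>By injectivity of \<open>r\<close> at most one countdown ends at this time, so
    the answer 1 leaves a single law rather than a sum.\<close>
  have S: "?S = {} \<or> (\<exists>z. ?S = {z})"
  proof (cases "?S = {}")
    case False
    then obtain z where "z \<in> ?S" by blast
    then have "?S = {z}" using r_inj by (auto dest: inj_onD)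
    then show ?thesis by blast
  qed simp
  have "1/2 * (\<Sum>z\<in>?S. H.V T n (lift (slots n) (?G z)))
      \<le> 1/2 * (\<Sum>z\<in>?S. H.V ?T (Suc n) (lift ((slots n)(n := Inr 0)) (?G z)))"
  proof (intro mult_left_mono sum_mono)
    fix z
    have "H.V T n (lift (slots n) (?G z)) \<le> H.V T (Suc n) (lift ((slots n)(n := Inr 0)) (?G z))"
      using n by (intro V_lift_cong_le) auto
    also have "\<dots> \<le> H.V ?T (Suc n) (lift ((slots n)(n := Inr 0)) (?G z))"
      by (intro H.V_mono lin_lift M.lin_reveal F) auto
    finally show "H.V T n (lift (slots n) (?G z)) \<le> \<dots>" .
  qed simp
  also have "\<dots> = H.V ?T (Suc n) (H.step n n 1 (walk n u F t))"
    using S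
  proof (elim disjE exE)
    assume "?S = {}"
    then show ?thesis unfolding walk_step(2)[OF F t] by (simp only: sum.empty H.V_zero mult_zero_right zero_less_Suc)
  next
    fix z assume S: "?S = {z}"
    have "H.V ?T (Suc n) (\<lambda>g. 1/2 * lift ((slots n)(n := Inr 0)) (?G z) g)
        = 1/2 * H.V ?T (Suc n) (lift ((slots n)(n := Inr 0)) (?G z))"
      by (subst H.V_scale) simp_all
    moreover have "(\<Sum>z\<in>{z}. f z) = f z" for f :: "'o \<Rightarrow> real" by simp
    ultimately show ?thesis unfolding walk_step(2)[OF F t] S by (simp only:)
  qed
  finally have 1: "1/2 * (\<Sum>z\<in>?S. H.V T n (lift (slots n) (?G z))) \<le> \<dots>" .
  have 2: "1/2 * (\<Sum>z\<in>{z \<in> Sg. Suc t \<le> r z}. H.V T n (lift (slots n) (?G z)))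
      + 1/2 * H.V T (Suc n) (lift (slots (Suc n)) (M.sample u n F))
    \<le> H.V ?T (Suc n) (H.step n n 0 (walk n u F t))"
    unfolding walk_step(1)[OF F t] using Suc t by (intro Suc.hyps(1)) auto
  have "(\<Sum>z\<in>{0, 1}. H.V ?T (Suc n) (H.step n n z (walk n u F t))) \<le> H.V (Suc ?T) (Suc n) (walk n u F t)"
    by (rule H.V_overwrite) simp_all
  then have 3: "H.V ?T (Suc n) (H.step n n 0 (walk n u F t)) + H.V ?T (Suc n) (H.step n n 1 (walk n u F t))
      \<le> H.V (Suc ?T) (Suc n) (walk n u F t)"
    by (simp del: One_nat_def)
  have 4: "T + (k - t) = Suc ?T" using t by simp
  have "{z \<in> Sg. t \<le> r z} = ?S \<union> {z \<in> Sg. Suc t \<le> r z}" by auto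
  then have 5: "(\<Sum>z\<in>{z \<in> Sg. t \<le> r z}. H.V T n (lift (slots n) (?G z)))
      = (\<Sum>z\<in>?S. H.V T n (lift (slots n) (?G z)))
        + (\<Sum>z\<in>{z \<in> Sg. Suc t \<le> r z}. H.V T n (lift (slots n) (?G z)))"
    using M.finite_Sg by (simp only:) (rule sum.union_disjoint; auto)
  show ?case unfolding 4 5 distrib_left using 1 2 3 by linarith
qed

lemma round_value:
  assumes F: "M.observed n F" and u: "u < n"
  shows "1/2 * (\<Sum>z\<in>Sg. H.V T n (lift (slots n) (M.reveal u z F)))
      + 1/2 * H.V T (Suc n) (lift (slots (Suc n)) (M.sample u n F))
    \<le> H.V (T + Suc k) n (lift (slots n) F)"
proof -
  have "{z \<in> Sg. 0 \<le> r z} = Sg" by simp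
  then have "1/2 * (\<Sum>z\<in>Sg. H.V T n (lift (slots n) (M.reveal u z F)))
      + 1/2 * H.V T (Suc n) (lift (slots (Suc n)) (M.sample u n F)) \<le> H.V (T + k) (Suc n) (walk n u F 0)"
    using walk_value[of F n 0 T u] F u by (simp add: M.observed_def)
  also have "\<dots> = H.V (T + k) (Suc n) (H.step u n 0 (lift (slots n) F))"
    by (simp only: walk_0[OF F u])
  also have "\<dots> \<le> (\<Sum>z\<in>{0, 1}. H.V (T + k) (Suc n) (H.step u n z (lift (slots n) F)))"
    by (rule member_le_sum) (auto intro: H.V_nonneg simp del: One_nat_def)
  also have "\<dots> \<le> H.V (Suc (T + k)) n (lift (slots n) F)"
    by (rule H.V_ge_query[OF u])
  finally show ?thesis by simp
qed

text \<open>The expected number of queries until the fair coin shows a prescribed side: two rounds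
  of \<open>k + 1\<close> queries on average.\<close>

definition rounds :: real where
  "rounds = 2 * (real k + 1)"

text \<open>Markov's inequality in a form suited to induction. An original query costs
  \<open>rounds\<close> on average to obtain a successor and \<open>rounds\<close> again to learn
  its observation; in the second claim one more observation is outstanding. The linear left factor
  can be averaged over the coin, and at \<open>T = B\<close> the lost fraction is the expected cost
  divided by \<open>B\<close>.\<close>

lemma simulation_lower_bound:
  assumes "T \<le> B"
  shows "\<lbrakk>M.observed n F; 0 < n\<rbrakk> \<Longrightarrow>
      (real T - 2 * rounds * m) * M.V m n F \<le> real B * H.V T n (lift (slots n) F)"
    and "\<lbrakk>M.observed n F; p < n\<rbrakk> \<Longrightarrow>
      (real T - rounds - 2 * rounds * m) * (\<Sum>z\<in>Sg. M.V m n (M.reveal p z F))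
        \<le> real B * H.V T n (lift (slots n) F)"
  using assms
proof (induction T arbitrary: m n F p rule: less_induct)
  case (less T)
  have scale: "1/2 * (real B * x) + 1/2 * (real B * y) \<le> real B * v" if "1/2 * x + 1/2 * y \<le> v" for x y v
    using mult_left_mono[OF that of_nat_0_le_iff[of B]]
    by (simp only: distrib_left mult.left_commute[of "real B" "1/2"])
  have D: "0 < rounds" "rounds = 2 * real (Suc k)" by (simp_all add: rounds_def)
  {
    case 2
    then have n: "0 < n" by simp
    let ?S = "\<Sum>z\<in>Sg. M.V m n (M.reveal p z F)"
    have S: "0 \<le> ?S" using n by (simp add: sum_nonneg M.V_nonneg)
    show ?case
    proof (cases "T < Suc k")
      \<comment> \<open>There is no time for a round, and the left factor is not positive.\<close>
      case True
      then have "real T \<le> rounds" by (simp add: rounds_def)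
      moreover have "0 \<le> 2 * rounds * real m" using D(1) by simp
      ultimately have "real T - rounds - 2 * rounds * real m \<le> 0" by linarith
      from this S have "(real T - rounds - 2 * rounds * m) * ?S \<le> 0" by (rule mult_nonpos_nonneg)
      also have "0 \<le> real B * H.V T n (lift (slots n) F)" using n by (simp add: H.V_nonneg del: One_nat_def)
      finally show ?thesis .
    next
      case False
      define T' where "T' = T - Suc k"
      have T: "T = T' + Suc k" "T' < T" "T' \<le> B" using False 2 by (auto simp: T'_def)
      have known: "(real T' - 2 * rounds * m) * ?S \<le> real B * (\<Sum>z\<in>Sg. H.V T' n (lift (slots n) (M.reveal p z F)))"
        unfolding sum_distrib_left
        using n 2 by (intro sum_mono less.IH(1) T M.observed_reveal)
      have unknown: "(real T' - rounds - 2 * rounds * m) * ?S \<le> real B * H.V T' n (lift (slots n) F)"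
        using 2 by (intro less.IH(2) T)
      \<comment> \<open>If the coin yields a successor instead of the observation, the successor is
        ignored and the attempt repeated.\<close>
      have "H.V T' n (lift (slots n) F) \<le> H.V T' (Suc n) (lift (slots (Suc n)) (M.sample p n F))"
        by (rule V_lift_sample_ge[OF n])
      with round_value[of n F p T'] 2
      have "1/2 * (\<Sum>z\<in>Sg. H.V T' n (lift (slots n) (M.reveal p z F))) + 1/2 * H.V T' n (lift (slots n) F)
          \<le> H.V T n (lift (slots n) F)"
        unfolding T(1) by linarith
      then have "1/2 * (real B * (\<Sum>z\<in>Sg. H.V T' n (lift (slots n) (M.reveal p z F))))
          + 1/2 * (real B * H.V T' n (lift (slots n) F)) \<le> real B * H.V T n (lift (slots n) F)"
        by (rule scale)
      \<comment> \<open>Both sides of the coin spend \<open>Suc k\<close> queries and one of them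
        saves \<open>rounds\<close>; half of \<open>rounds\<close> is \<open>Suc k\<close>, so the
        average is exact.\<close>
      moreover have "(real T - rounds - 2 * rounds * m) * ?S
        = 1/2 * ((real T' - 2 * rounds * m) * ?S) + 1/2 * ((real T' - rounds - 2 * rounds * m) * ?S)"
        unfolding T(1) D(2) by (simp add: algebra_simps)
      ultimately show ?thesis using known unknown by linarith
    qed
  }
  {
    case 1
    then have n: "0 < n" by simp
    show ?case
    proof (cases m)
      case 0
      have "M.V 0 n F = H.V 0 n (lift (slots n) F)" by (simp add: lift_apply del: One_nat_def)
      also have "\<dots> \<le> H.V T n (lift (slots n) F)"
        using 1 by (intro H.V_mono lin_lift) (auto simp: M.observed_def)
      finally have "real T * M.V 0 n F \<le> real B * H.V T n (lift (slots n) F)"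
        using 1 by (intro mult_mono) auto
      then show ?thesis using 0 by simp
    next
      case (Suc m')
      have V: "0 \<le> M.V m n F" by (rule M.V_nonneg[OF n])
      show ?thesis
      proof (cases "T < Suc k")
        case True
        then have "real T \<le> rounds" by (simp add: rounds_def)
        moreover have "rounds * 1 \<le> 2 * rounds * real m" using D(1) Suc by (simp add: algebra_simps)
        ultimately have "real T - 2 * rounds * real m \<le> 0" by linarith
        from this V have "(real T - 2 * rounds * m) * M.V m n F \<le> 0" by (rule mult_nonpos_nonneg)
        also have "0 \<le> real B * H.V T n (lift (slots n) F)" using n by (simp add: H.V_nonneg del: One_nat_def)
        finally show ?thesis .
      next
        case False
        define T' where "T' = T - Suc k"
        have T: "T = T' + Suc k" "T' < T" "T' \<le> B" using False 1 by (auto simp: T'_def)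
        obtain u where u: "u < n" and
          eq: "M.V (Suc m') n F = (\<Sum>z\<in>Sg. M.V m' (Suc n) (M.step u n z F))"
          by (rule M.V_query_obtain[OF n])
        \<comment> \<open>On the countdown side the observation learnt is ignored and the same
          original query is attempted again; on the other side the successor is there and only its
          observation is outstanding.\<close>
        have retry: "(real T' - 2 * rounds * m) * M.V m n F \<le> real B * H.V T' n (lift (slots n) F)"
          using 1 by (intro less.IH(1) T)
        have "(real T' - rounds - 2 * rounds * m') * (\<Sum>z\<in>Sg. M.V m' (Suc n) (M.reveal n z (M.sample u n F)))
            \<le> real B * H.V T' (Suc n) (lift (slots (Suc n)) (M.sample u n F))"
          using 1 by (intro less.IH(2) T M.observed_sample) auto
        then have new: "(real T' - rounds - 2 * rounds * m') * M.V m n F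
            \<le> real B * H.V T' (Suc n) (lift (slots (Suc n)) (M.sample u n F))"
          unfolding Suc eq M.step_def .
        have "H.V T' n (lift (slots n) F) \<le> (\<Sum>z\<in>Sg. H.V T' n (lift (slots n) (M.reveal u z F)))"
        proof -
          have "lift (slots n) F = (\<lambda>g. \<Sum>z\<in>Sg. lift (slots n) (M.reveal u z F) g)"
            unfolding lift_def
            by (rule ext) (rule fun_cong[OF M.sum_reveal_observed[OF 1(1) u]])
          then show ?thesis using H.V_sum[OF n] by metis
        qed
        with round_value[OF 1(1) u, of T']
        have "1/2 * H.V T' n (lift (slots n) F)
            + 1/2 * H.V T' (Suc n) (lift (slots (Suc n)) (M.sample u n F)) \<le> H.V T n (lift (slots n) F)"
          unfolding T(1) by linarith
        then have "1/2 * (real B * H.V T' n (lift (slots n) F))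
            + 1/2 * (real B * H.V T' (Suc n) (lift (slots (Suc n)) (M.sample u n F)))
            \<le> real B * H.V T n (lift (slots n) F)"
          by (rule scale)
        moreover have "(real T - 2 * rounds * m) * M.V m n F
          = 1/2 * ((real T' - 2 * rounds * m) * M.V m n F) + 1/2 * ((real T' - rounds - 2 * rounds * m') * M.V m n F)"
          unfolding T(1) D(2) Suc by (simp add: algebra_simps)
        ultimately show ?thesis using retry new by linarith
      qed
    qed
  }
qed

lemma V_walk_path:
  assumes "lin F" "u < n" "lab u = Inl (p, 0)" "j \<le> k"
  shows "H.V T n (lift (lab(u := Inl (p, j))) F) \<le> H.V (T + j) n (lift lab F)"
  using assms(4)
proof (induction j arbitrary: T)
  case 0
  then show ?case using assms(3) fun_upd_idem[of lab u] by simp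
next
  case (Suc j)
  then have j: "j < k" by simp
  let ?lab = "lab(u := Inl (p, j))"
  have "H.step u u z (lift ?lab F) = (if z = 0 then lift (lab(u := Inl (p, Suc j))) F else (\<lambda>g. 0))" for z
    using step_lift_path[where lab="?lab" and h=u and n=u and z=z, OF fun_upd_same j assms(1)] by simp
  then have "H.V T n (lift (lab(u := Inl (p, Suc j))) F) \<le> (\<Sum>z\<in>{0, 1}. H.V T n (H.step u u z (lift ?lab F)))"
    using assms(2) by (simp add: H.V_zero del: One_nat_def)
  also have "\<dots> \<le> H.V (Suc T) n (lift ?lab F)"
    by (rule H.V_overwrite) (fact assms(2))+
  also have "\<dots> \<le> H.V (Suc T + j) n (lift lab F)"
    by (rule Suc.IH) (use j in simp)
  finally show ?case by (simp only: add_Suc add_Suc_right)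
qed

lemma full_value_lower_bound:
  assumes ab: "ob a \<in> Sg" "ob b \<in> Sg" and m: "M.full_value m a b \<ge> 2/3"
  shows "H.full_value (12 * Suc k * (1 + 6 * m) + k) (Inl (a, 0)) (Inl (b, 0)) \<ge> 2/3"
proof -
  \<comment> \<open>\<open>?T\<close> is six times \<open>rounds * (1 + 2 * (3 * m))\<close>, the
    expected cost of \<open>3 * m\<close> original queries and the initial observation. So 5/6 of
    the amplified 4/5 survives, which is 2/3. The additional \<open>k\<close> queries walk along the
    initial path.\<close>
  let ?T = "12 * Suc k * (1 + 6 * m)" and ?F = "difference a b" and ?lab = "\<lambda>_. Inl (0, 0) :: (nat \<times> nat) + nat"
  have "M.observed 1 ?F"
    using ab lin_difference[of a b] by (simp add: M.observed_def carried_def difference_def)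
  from simulation_lower_bound(2)[OF order_refl this zero_less_one, of ?T "3 * m"]
  have "(real ?T - rounds - 2 * rounds * real (3 * m)) * M.full_value (3 * m) a b \<le> real ?T * H.V ?T 1 (lift (slots 1) ?F)"
    by (simp only: M.full_value_def difference_def)
  moreover have "real ?T - rounds - 2 * rounds * real (3 * m) = 5/6 * real ?T"
    by (simp add: rounds_def algebra_simps)
  ultimately have 1: "5/6 * real ?T * M.full_value (3 * m) a b \<le> real ?T * H.V ?T 1 (lift (slots 1) ?F)"
    by (simp only:)
  have "t * (2/3) = 5/6 * t * (4/5)" for t :: real by simp
  then have "real ?T * (2/3) = 5/6 * real ?T * (4/5)" .
  also have "\<dots> \<le> 5/6 * real ?T * M.full_value (3 * m) a b"
    by (intro mult_left_mono M.full_value_amplification[OF m ab]) simp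
  also note 1
  finally have "real ?T * (2/3) \<le> real ?T * H.V ?T 1 (lift (slots 1) ?F)" .
  then have "2/3 \<le> H.V ?T 1 (lift (slots 1) ?F)"
    by (rule mult_left_le_imp_le) (simp only: of_nat_0_less_iff, simp)
  also have "\<dots> \<le> H.V ?T 1 (lift (?lab(0 := Inl (0, k))) ?F)"
    by (intro V_lift_cong_le) (auto simp: slots_def)
  also have "\<dots> \<le> H.V (?T + k) 1 (lift ?lab ?F)"
    by (intro V_walk_path lin_difference) auto
  finally show ?thesis unfolding full_value_encoded .
qed

end

section \<open>Query complexity and values\<close>

text \<open>Missing entries default to the initial state, so that a history of length one becomes
  the constant configuration used in \<open>full_value\<close>.\<close>

definition config_of :: "'a list \<Rightarrow> nat \<Rightarrow> 'a" where
  "config_of xs i = (if i < length xs then xs ! i else xs ! 0)"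

lemma config_of_single: "config_of [x] = (\<lambda>_. x)"
  by (auto simp: config_of_def)

lemma config_of_snoc: "xs \<noteq> [] \<Longrightarrow> config_of (xs @ [y]) = (config_of xs)(length xs := y)"
  by (auto simp: config_of_def nth_append fun_eq_iff)

lemma sum_lists_Suc:
  assumes "finite S"
  shows "(\<Sum>v | set v \<subseteq> S \<and> length v = Suc n. f v) = (\<Sum>z\<in>S. \<Sum>v | set v \<subseteq> S \<and> length v = n. f (z # v))"
proof -
  let ?L = "\<lambda>n. {v. set v \<subseteq> S \<and> length v = n}"
  have "?L (Suc n) = (\<lambda>(z, v). z # v) ` (S \<times> ?L n)"
    by (auto simp: length_Suc_conv image_iff)
  moreover have "inj_on (\<lambda>(z, v). z # v) (S \<times> ?L n)"
    by (auto simp: inj_on_def)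
  ultimately have "sum f (?L (Suc n)) = sum (f \<circ> (\<lambda>(z, v). z # v)) (S \<times> ?L n)"
    by (simp only: sum.reindex)
  also have "\<dots> = (\<Sum>(z, v)\<in>S \<times> ?L n. f (z # v))"
    by (simp add: split_beta)
  finally have "sum f (?L (Suc n)) = (\<Sum>(z, v)\<in>S \<times> ?L n. f (z # v))" .
  then show ?thesis by (simp add: sum.cartesian_product)
qed

lemma set_history_subset:
  assumes "pomc M" "a \<in> states M"
  shows "xs \<in> set_pmf (history M A a t) \<Longrightarrow> set xs \<subseteq> states M \<and> length xs = Suc t"
proof (induction t arbitrary: xs)
  case (Suc t)
  then obtain ys y where ys: "ys \<in> set_pmf (history M A a t)" and xs: "xs = ys @ [y]"
    and y: "y \<in> set_pmf (kernel M (ys ! (t - A (map (obs M) ys))))" by auto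
  from Suc.IH[OF ys] have "ys ! (t - A (map (obs M) ys)) \<in> states M"
    by (metis diff_less_Suc nth_mem subsetD)
  with y assms(1) have "y \<in> states M" unfolding pomc_def by blast
  with Suc.IH[OF ys] show ?case by (simp add: xs)
qed (use assms in simp)

locale pomc_system = query_system E "obs M" "alphabet M"
  for M :: "('a, 'o) pomc" and E :: "'a \<Rightarrow> ('a \<Rightarrow> real) \<Rightarrow> real" +
  assumes pomc: "pomc M"
    and E_kernel: "x \<in> states M \<Longrightarrow> E x g = measure_pmf.expectation (kernel M x) g"
begin

lemma obs_alphabet: "x \<in> states M \<Longrightarrow> obs M x \<in> alphabet M"
  using pomc by (auto simp: pomc_def)

definition hists :: "nat \<Rightarrow> 'a list set" where
  "hists t = {xs. set xs \<subseteq> states M \<and> length xs = Suc t}"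

lemma finite_hists: "finite (hists t)"
  using pomc by (auto simp: hists_def pomc_def intro: finite_lists_length_eq)

lemma nth_hists: "xs \<in> hists t \<Longrightarrow> i \<le> t \<Longrightarrow> xs ! i \<in> states M"
  unfolding hists_def using nth_mem by fastforce

lemma set_pmf_history: "a \<in> states M \<Longrightarrow> set_pmf (history M A a t) \<subseteq> hists t"
  using set_history_subset[OF pomc] unfolding hists_def by blast

section \<open>Laws of hidden histories along an observation word\<close>

definition hexp :: "('o list \<Rightarrow> nat) \<Rightarrow> 'a \<Rightarrow> nat \<Rightarrow> ('a list \<Rightarrow> real) \<Rightarrow> real" where
  "hexp A a t g = measure_pmf.expectation (history M A a t) g"

lemma hexp_eq_sum:
  "a \<in> states M \<Longrightarrow> hexp A a t g = (\<Sum>xs\<in>hists t. pmf (history M A a t) xs * g xs)"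
  unfolding hexp_def
  by (subst integral_measure_pmf[OF finite_hists]) (use set_pmf_history in auto)

lemma hexp_cong:
  "a \<in> states M \<Longrightarrow> (\<And>xs. xs \<in> hists t \<Longrightarrow> g xs = h xs) \<Longrightarrow> hexp A a t g = hexp A a t h"
  by (simp add: hexp_eq_sum)

lemma hexp_0: "hexp A a 0 g = g [a]"
  by (simp add: hexp_def)

lemma hexp_Suc:
  assumes "a \<in> states M"
  shows "hexp A a (Suc t) g
    = hexp A a t (\<lambda>xs. E (xs ! (t - A (map (obs M) xs))) (\<lambda>y. g (xs @ [y])))"
proof -
  let ?k = "\<lambda>xs. kernel M (xs ! (t - A (map (obs M) xs)))"
  have st: "xs ! (t - A (map (obs M) xs)) \<in> states M" if "xs \<in> hists t" for xs
    using nth_hists[OF that] by simp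
  have fin: "finite (set_pmf (map_pmf (\<lambda>y. xs @ [y]) (?k xs)))" if "xs \<in> hists t" for xs
    using st[OF that] pomc finite_subset unfolding pomc_def by fastforce
  have "hexp A a (Suc t) g = (\<Sum>xs\<in>hists t. pmf (history M A a t) xs *
      measure_pmf.expectation (map_pmf (\<lambda>y. xs @ [y]) (?k xs)) g)"
    unfolding hexp_def history.simps
    by (subst pmf_expectation_bind[OF finite_hists fin set_pmf_history[OF assms]]) auto
  also have "\<dots> = (\<Sum>xs\<in>hists t. pmf (history M A a t) xs *
      E (xs ! (t - A (map (obs M) xs))) (\<lambda>y. g (xs @ [y])))"
    by (rule sum.cong) (simp_all add: E_kernel st)
  also have "\<dots> = hexp A a t (\<lambda>xs. E (xs ! (t - A (map (obs M) xs))) (\<lambda>y. g (xs @ [y])))"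
    by (simp add: hexp_eq_sum assms)
  finally show ?thesis .
qed

text \<open>The unnormalized law of the hidden history on the event that the observations are
  \<open>w\<close>. There is one query fewer than letters, the first letter being free.\<close>

definition hidden_law :: "('o list \<Rightarrow> nat) \<Rightarrow> 'a \<Rightarrow> 'o list \<Rightarrow> 'a functional" where
  "hidden_law A a w = (\<lambda>g. hexp A a (length w - 1)
     (\<lambda>xs. if map (obs M) xs = w then g (config_of xs) else 0))"

lemma hidden_law_single: "hidden_law A a [z] = reveal 0 z (\<lambda>g. g (\<lambda>_. a))"
  by (auto simp: hidden_law_def hexp_0 config_of_single reveal_def fun_eq_iff)

text \<open>On the event described by \<open>w\<close> a deterministic strategy makes a fixed
  choice, so one further letter is one \<open>step\<close>.\<close>

lemma hidden_law_snoc: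
  assumes a: "a \<in> states M" and w: "w \<noteq> []"
  shows "hidden_law A a (w @ [z]) = step (length w - 1 - A w) (length w) z (hidden_law A a w)"
proof (rule ext)
  fix g
  obtain t where t: "length w = Suc t" using w by (cases w) auto
  have "hidden_law A a (w @ [z]) g = hexp A a (Suc t) (\<lambda>xs. if map (obs M) xs = w @ [z] then g (config_of xs) else 0)"
    by (simp add: hidden_law_def t)
  also have "\<dots> = hexp A a t (\<lambda>xs. E (xs ! (t - A (map (obs M) xs)))
      (\<lambda>y. if map (obs M) (xs @ [y]) = w @ [z] then g (config_of (xs @ [y])) else 0))"
    by (rule hexp_Suc[OF a])
  also have "\<dots> = hexp A a t (\<lambda>xs. if map (obs M) xs = w then E (config_of xs (t - A w))
      (\<lambda>y. if obs M y = z then g ((config_of xs)(Suc t := y)) else 0) else 0)"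
  proof (rule hexp_cong[OF a])
    fix xs assume "xs \<in> hists t"
    then have xs: "length xs = Suc t" "xs \<noteq> []" by (auto simp: hists_def)
    show "E (xs ! (t - A (map (obs M) xs)))
      (\<lambda>y. if map (obs M) (xs @ [y]) = w @ [z] then g (config_of (xs @ [y])) else 0)
      = (if map (obs M) xs = w then E (config_of xs (t - A w))
      (\<lambda>y. if obs M y = z then g ((config_of xs)(Suc t := y)) else 0) else 0)"
    proof (cases "map (obs M) xs = w")
      case True
      have "config_of xs (t - A w) = xs ! (t - A w)"
        using xs by (simp add: config_of_def)
      moreover have "(if map (obs M) (xs @ [y]) = w @ [z] then g (config_of (xs @ [y])) else 0)
          = (if obs M y = z then g ((config_of xs)(Suc t := y)) else 0)" for y
        using True xs config_of_snoc[OF xs(2), of y] by simp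
      ultimately show ?thesis by (simp only: True if_True simp_thms)
    next
      case False
      then show ?thesis by (simp add: E_const)
    qed
  qed
  also have "\<dots> = step (length w - 1 - A w) (length w) z (hidden_law A a w) g"
    by (simp add: step_apply hidden_law_def t)
  finally show "hidden_law A a (w @ [z]) g = step (length w - 1 - A w) (length w) z (hidden_law A a w) g" .
qed

lemma pmf_obs:
  assumes "length w = Suc t"
  shows "pmf (map_pmf (map (obs M)) (history M A a t)) w = hidden_law A a w (\<lambda>_. 1)"
proof -
  have "(\<lambda>xs. if map (obs M) xs = w then 1 else 0) = indicat_real (map (obs M) -` {w})"
    by (auto simp: indicator_def fun_eq_iff)
  then show ?thesis
    using assms by (simp add: pmf_map hidden_law_def hexp_def)
qed

definition law_difference :: "('o list \<Rightarrow> nat) \<Rightarrow> 'a \<Rightarrow> 'a \<Rightarrow> 'o list \<Rightarrow> 'a functional" where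
  "law_difference A a b w = (\<lambda>g. hidden_law A a w g - hidden_law A b w g)"

lemma law_difference_single:
  "law_difference A a b [z] = reveal 0 z (\<lambda>g. g (\<lambda>_. a) - g (\<lambda>_. b))"
  by (simp add: law_difference_def hidden_law_single reveal_def)

lemma law_difference_snoc:
  assumes "a \<in> states M" "b \<in> states M" "w \<noteq> []"
  shows "law_difference A a b (w @ [z]) = step (length w - 1 - A w) (length w) z (law_difference A a b w)"
  by (rule ext) (simp add: law_difference_def hidden_law_snoc assms step_apply)

definition words :: "nat \<Rightarrow> 'o list set" where
  "words n = {w. set w \<subseteq> alphabet M \<and> length w = n}"

lemma sum_words_Suc: "(\<Sum>v\<in>words (Suc n). f v) = (\<Sum>z\<in>alphabet M. \<Sum>v\<in>words n. f (z # v))"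
  unfolding words_def by (rule sum_lists_Suc[OF finite_Sg])

lemma sum_words_0: "(\<Sum>v\<in>words 0. f v) = f []"
proof -
  have "words 0 = {[]}" by (auto simp: words_def)
  then show ?thesis by simp
qed

lemma law_difference_le_V:
  assumes "a \<in> states M" "b \<in> states M" "w \<noteq> []"
  shows "(\<Sum>v\<in>words s. \<bar>law_difference A a b (w @ v) (\<lambda>_. 1)\<bar>) \<le> V s (length w) (law_difference A a b w)"
  using assms(3)
proof (induction s arbitrary: w)
  case 0
  then show ?case by (simp add: sum_words_0)
next
  case (Suc s)
  let ?u = "length w - 1 - A w"
  have "?u < length w" using Suc.prems by (cases w) auto
  have "(\<Sum>v\<in>words (Suc s). \<bar>law_difference A a b (w @ v) (\<lambda>_. 1)\<bar>)
      = (\<Sum>z\<in>alphabet M. \<Sum>v\<in>words s. \<bar>law_difference A a b ((w @ [z]) @ v) (\<lambda>_. 1)\<bar>)"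
    by (simp add: sum_words_Suc)
  also have "\<dots> \<le> (\<Sum>z\<in>alphabet M. V s (length (w @ [z])) (law_difference A a b (w @ [z])))"
    by (intro sum_mono Suc.IH) simp
  also have "\<dots> = (\<Sum>z\<in>alphabet M. V s (Suc (length w)) (step ?u (length w) z (law_difference A a b w)))"
    using Suc.prems by (simp add: law_difference_snoc assms)
  also have "\<dots> \<le> V (Suc s) (length w) (law_difference A a b w)"
    by (rule V_ge_query) fact
  finally show ?case .
qed

text \<open>Maximizing queries are chosen at every word. The choice at \<open>w\<close> depends on
  the law at \<open>w\<close>, which depends on the choices at shorter prefixes.\<close>

lemma exists_optimal_strategy:
  assumes "a \<in> states M" "b \<in> states M"
  obtains A where "\<And>s w. w \<noteq> [] \<Longrightarrow> length w + s = Suc T \<Longrightarrow>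
    V s (length w) (law_difference A a b w) \<le> (\<Sum>v\<in>words s. \<bar>law_difference A a b (w @ v) (\<lambda>_. 1)\<bar>)"
proof -
  define best where "best = (\<lambda>s n F. SOME u. u < n \<and> V (Suc s) n F =
      (\<Sum>z\<in>alphabet M. V s (Suc n) (step u n z F)))"
  have best: "best s n F < n \<and> V (Suc s) n F = (\<Sum>z\<in>alphabet M. V s (Suc n) (step (best s n F) n z F))"
    if "0 < n" for s n F
    unfolding best_def by (rule someI_ex) (use V_query_obtain[OF that, of s F] in metis)
  \<comment> \<open>Recursion over the reversed word resolves this circularity, with the latest
    observation at the head. The fixed horizon \<open>T\<close> determines how many queries
    remain.\<close>
  define law where "law = rec_list (\<lambda>g. 0) (\<lambda>z v F. if v = [] then reveal 0 z (\<lambda>g. g (\<lambda>_. a) - g (\<lambda>_. b))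
      else step (best (T - length v) (length v) F) (length v) z F)"
  \<comment> \<open>The chosen index is below \<open>length w\<close>, so subtracting twice from
    \<open>length w - 1\<close> recovers it.\<close>
  define A where "A = (\<lambda>w. length w - 1 - best (T - length w) (length w) (law (rev w)))"
  have A: "length w - 1 - A w = best (T - length w) (length w) (law (rev w))" if "w \<noteq> []" for w
    using best[of "length w" "T - length w" "law (rev w)"] that unfolding A_def by (cases w) auto
  have law: "law_difference A a b w = law (rev w)" if "w \<noteq> []" for w
    using that
  proof (induction w rule: rev_induct)
    case (snoc z w)
    show ?case
    proof (cases "w = []")
      case True
      then show ?thesis by (simp add: law_difference_single law_def)
    next
      case False
      have "law (rev (w @ [z])) = step (best (T - length w) (length w) (law (rev w))) (length w) z (law (rev w))"
        using False by (simp add: law_def)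
      with False snoc.IH show ?thesis
        by (simp only: law_difference_snoc[OF assms False] A not_False_eq_True)
    qed
  qed simp
  have "V s (length w) (law_difference A a b w) \<le> (\<Sum>v\<in>words s. \<bar>law_difference A a b (w @ v) (\<lambda>_. 1)\<bar>)"
    if "w \<noteq> []" "length w + s = Suc T" for s w
    using that
  proof (induction s arbitrary: w)
    case 0
    then show ?case by (simp add: sum_words_0)
  next
    case (Suc s)
    then have s: "T - length w = s" and w: "0 < length w" by auto
    have "V (Suc s) (length w) (law_difference A a b w)
        = (\<Sum>z\<in>alphabet M. V s (Suc (length w)) (step (length w - 1 - A w) (length w) z (law_difference A a b w)))"
      using best[OF w, of s "law (rev w)"] by (simp only: A[OF Suc.prems(1)] s law[OF Suc.prems(1)])
    also have "\<dots> = (\<Sum>z\<in>alphabet M. V s (length (w @ [z])) (law_difference A a b (w @ [z])))"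
      using Suc.prems by (simp add: law_difference_snoc assms)
    also have "\<dots> \<le> (\<Sum>z\<in>alphabet M. \<Sum>v\<in>words s. \<bar>law_difference A a b ((w @ [z]) @ v) (\<lambda>_. 1)\<bar>)"
      using Suc.prems by (intro sum_mono Suc.IH) auto
    also have "\<dots> = (\<Sum>v\<in>words (Suc s). \<bar>law_difference A a b (w @ v) (\<lambda>_. 1)\<bar>)"
      by (simp add: sum_words_Suc)
    finally show ?case .
  qed
  then show ?thesis by (rule that)
qed

lemma sum_words_difference_le:
  assumes "a \<in> states M" "b \<in> states M"
  shows "(\<Sum>w\<in>words (Suc T). \<bar>law_difference A a b w (\<lambda>_. 1)\<bar>) \<le> full_value T a b"
proof -
  have "(\<Sum>v\<in>words T. \<bar>law_difference A a b (z # v) (\<lambda>_. 1)\<bar>)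
      \<le> V T 1 (reveal 0 z (\<lambda>g. g (\<lambda>_. a) - g (\<lambda>_. b)))" for z
    using law_difference_le_V[OF assms, of "[z]" A T] by (simp add: law_difference_single)
  then show ?thesis unfolding sum_words_Suc full_value_def by (rule sum_mono)
qed

lemma exists_strategy_full_value:
  assumes "a \<in> states M" "b \<in> states M"
  obtains A where "full_value T a b \<le> (\<Sum>w\<in>words (Suc T). \<bar>law_difference A a b w (\<lambda>_. 1)\<bar>)"
proof -
  obtain A where A: "\<And>s w. w \<noteq> [] \<Longrightarrow> length w + s = Suc T \<Longrightarrow>
    V s (length w) (law_difference A a b w) \<le> (\<Sum>v\<in>words s. \<bar>law_difference A a b (w @ v) (\<lambda>_. 1)\<bar>)"
    using exists_optimal_strategy[OF assms] by blast
  have "V T 1 (reveal 0 z (\<lambda>g. g (\<lambda>_. a) - g (\<lambda>_. b)))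
      \<le> (\<Sum>v\<in>words T. \<bar>law_difference A a b (z # v) (\<lambda>_. 1)\<bar>)" for z
    using A[of "[z]" T] by (simp add: law_difference_single)
  then have "full_value T a b \<le> (\<Sum>w\<in>words (Suc T). \<bar>law_difference A a b w (\<lambda>_. 1)\<bar>)"
    unfolding full_value_def sum_words_Suc by (rule sum_mono)
  then show ?thesis by (rule that)
qed

section \<open>Measurability and randomized strategies\<close>

abbreviation strategy_space :: "('o list \<Rightarrow> nat) measure" where
  "strategy_space \<equiv> Pi\<^sub>M UNIV (\<lambda>_. count_space UNIV)"

lemma measurable_strategy_value: "(\<lambda>A. h (A w) :: real) \<in> borel_measurable strategy_space"
  by (rule measurable_compose[OF measurable_component_singleton]) auto

text \<open>Only finitely many histories are possible, and each transition depends on the strategy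
  through its value at a single word.\<close>

lemma measurable_history:
  assumes "a \<in> states M"
  shows "(\<lambda>A. pmf (history M A a t) zs) \<in> borel_measurable strategy_space"
proof (induction t arbitrary: zs)
  case 0
  then show ?case by simp
next
  case (Suc t)
  have "pmf (history M A a (Suc t)) zs = hexp A a (Suc t) (indicat_real {zs})" for A
    by (simp add: hexp_def measure_pmf_single)
  also have "hexp A a (Suc t) (indicat_real {zs})
      = hexp A a t (\<lambda>xs. E (xs ! (t - A (map (obs M) xs))) (\<lambda>y. indicat_real {zs} (xs @ [y])))" for A
    by (rule hexp_Suc[OF assms])
  also have "hexp A a t (\<lambda>xs. E (xs ! (t - A (map (obs M) xs))) (\<lambda>y. indicat_real {zs} (xs @ [y])))
      = (\<Sum>xs\<in>hists t. pmf (history M A a t) xs *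
          E (xs ! (t - A (map (obs M) xs))) (\<lambda>y. indicat_real {zs} (xs @ [y])))" for A
    by (rule hexp_eq_sum[OF assms])
  finally have *: "pmf (history M A a (Suc t)) zs = (\<Sum>xs\<in>hists t. pmf (history M A a t) xs *
      E (xs ! (t - A (map (obs M) xs))) (\<lambda>y. indicat_real {zs} (xs @ [y])))" for A .
  show ?case
    unfolding * by (intro borel_measurable_sum borel_measurable_times Suc.IH measurable_strategy_value)
qed

lemma measurable_hidden_law:
  assumes "a \<in> states M"
  shows "(\<lambda>A. hidden_law A a w g) \<in> borel_measurable strategy_space"
  unfolding hidden_law_def hexp_eq_sum[OF assms]
  by (intro borel_measurable_sum borel_measurable_times measurable_history assms) simp

lemma hidden_law_one_bounds:
  assumes "length w = Suc t"
  shows "0 \<le> hidden_law A a w (\<lambda>_. 1)" "hidden_law A a w (\<lambda>_. 1) \<le> 1"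
  unfolding pmf_obs[OF assms, symmetric] by (simp_all add: pmf_le_1)

lemma obs_tv_eq:
  "obs_tv M N a b T = (\<Sum>w\<in>words (Suc T). \<bar>(\<integral>A. hidden_law A a w (\<lambda>_. 1) \<partial>N) - (\<integral>A. hidden_law A b w (\<lambda>_. 1) \<partial>N)\<bar>) / 2"
  unfolding obs_tv_def obs_prob_def words_def
  by (intro arg_cong[where f="\<lambda>x. x / 2"] sum.cong) (simp_all add: pmf_obs)

text \<open>The absolute value of an average is at most the average of the absolute values, and each
  deterministic strategy obeys the bound.\<close>

lemma obs_tv_le_full_value:
  assumes "a \<in> states M" "b \<in> states M" "N \<in> strategies"
  shows "obs_tv M N a b T \<le> full_value T a b / 2"
proof -
  interpret N: prob_space N using assms(3) by (simp add: strategies_def)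
  have sets: "sets N = sets strategy_space" using assms(3) by (simp add: strategies_def)
  have int: "integrable N (\<lambda>A. hidden_law A x w (\<lambda>_. 1))" if "x \<in> states M" "w \<in> words (Suc T)" for x w
  proof (rule N.integrable_const_bound)
    show "AE A in N. norm (hidden_law A x w (\<lambda>_. 1)) \<le> 1"
      using hidden_law_one_bounds[of w T] that by (simp add: words_def)
    show "(\<lambda>A. hidden_law A x w (\<lambda>_. 1)) \<in> borel_measurable N"
      using measurable_hidden_law[OF that(1)] by (simp add: measurable_cong_sets[OF sets refl])
  qed
  have int': "integrable N (\<lambda>A. law_difference A a b w (\<lambda>_. 1))" if "w \<in> words (Suc T)" for w
    unfolding law_difference_def using int assms that by simp
  have "(\<Sum>w\<in>words (Suc T). \<bar>(\<integral>A. hidden_law A a w (\<lambda>_. 1) \<partial>N) - (\<integral>A. hidden_law A b w (\<lambda>_. 1) \<partial>N)\<bar>)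
      = (\<Sum>w\<in>words (Suc T). \<bar>\<integral>A. law_difference A a b w (\<lambda>_. 1) \<partial>N\<bar>)"
    unfolding law_difference_def using int assms by simp
  also have "\<dots> \<le> (\<Sum>w\<in>words (Suc T). \<integral>A. \<bar>law_difference A a b w (\<lambda>_. 1)\<bar> \<partial>N)"
    by (intro sum_mono integral_abs_bound)
  also have "\<dots> = (\<integral>A. (\<Sum>w\<in>words (Suc T). \<bar>law_difference A a b w (\<lambda>_. 1)\<bar>) \<partial>N)"
    using int' by (intro Bochner_Integration.integral_sum[symmetric]) auto
  also have "\<dots> \<le> (\<integral>A. full_value T a b \<partial>N)"
    using int' sum_words_difference_le[OF assms(1,2)]
    by (intro integral_mono Bochner_Integration.integrable_sum) auto
  also have "\<dots> = full_value T a b" by (simp add: N.prob_space)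
  finally show ?thesis unfolding obs_tv_eq by simp
qed

lemma exists_strategy_obs_tv:
  assumes "a \<in> states M" "b \<in> states M"
  obtains N where "N \<in> strategies" "full_value T a b / 2 \<le> obs_tv M N a b T"
proof -
  obtain A where A: "full_value T a b \<le> (\<Sum>w\<in>words (Suc T). \<bar>law_difference A a b w (\<lambda>_. 1)\<bar>)"
    using exists_strategy_full_value[OF assms] .
  let ?N = "return strategy_space A"
  have A_space: "A \<in> space strategy_space" by (simp add: space_PiM)
  have "(\<integral>A. hidden_law A x w (\<lambda>_. 1) \<partial>?N) = hidden_law A x w (\<lambda>_. 1)" if "x \<in> states M" for x w
    by (rule integral_return[OF A_space measurable_hidden_law[OF that]])
  then have "obs_tv M ?N a b T = (\<Sum>w\<in>words (Suc T). \<bar>law_difference A a b w (\<lambda>_. 1)\<bar>) / 2"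
    unfolding obs_tv_eq law_difference_def using assms by simp
  moreover have "?N \<in> strategies"
    using prob_space_return[OF A_space] by (simp add: strategies_def)
  ultimately show ?thesis using A by (intro that[of ?N]) auto
qed

text \<open>The threshold 1/3 becomes 2/3 because \<open>full_value\<close> is twice a total
  variation distance; an earlier success persists by monotonicity.\<close>

lemma AQC_le_iff:
  assumes "a \<in> states M" "b \<in> states M"
  shows "AQC M a b \<le> enat T \<longleftrightarrow> 2/3 \<le> full_value T a b"
proof
  assume "AQC M a b \<le> enat T"
  \<comment> \<open>A strict bound on an infimum yields a witness.\<close>
  then have "AQC M a b < enat (Suc T)"
    by (rule order.strict_trans1) simp
  then obtain N where N: "N \<in> strategies" "QC M N a b < enat (Suc T)"
    unfolding AQC_def by (auto simp: INF_less_iff)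
  then obtain T' where T': "1/3 \<le> obs_tv M N a b T'" "T' < Suc T"
    unfolding QC_def by (auto simp: Inf_less_iff)
  with obs_tv_le_full_value[OF assms N(1), of T'] have "2/3 \<le> full_value T' a b" by simp
  also have "\<dots> \<le> full_value T a b" using T' by (intro full_value_mono) simp
  finally show "2/3 \<le> full_value T a b" .
next
  assume *: "2/3 \<le> full_value T a b"
  obtain N where N: "N \<in> strategies" "full_value T a b / 2 \<le> obs_tv M N a b T"
    using exists_strategy_obs_tv[OF assms] .
  then have "1/3 \<le> obs_tv M N a b T" using * by simp
  then have "QC M N a b \<le> enat T"
    unfolding QC_def by (intro Inf_lower) auto
  then show "AQC M a b \<le> enat T"
    unfolding AQC_def by (rule INF_lower2[OF N(1)])
qed

end

section \<open>The canonical chain\<close>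

text \<open>Transport along an injection, used to move the encoded chain to natural numbers as
  states.\<close>

definition rename :: "('b \<Rightarrow> nat) \<Rightarrow> ('b, 'o) pomc \<Rightarrow> (nat, 'o) pomc" where
  "rename f M = \<lparr>states = f ` states M,
     kernel = (\<lambda>n. map_pmf f (kernel M (inv_into (states M) f n))),
     alphabet = alphabet M,
     obs = (\<lambda>n. obs M (inv_into (states M) f n))\<rparr>"

lemma rename_simps [simp]:
  "states (rename f M) = f ` states M" "alphabet (rename f M) = alphabet M"
  by (simp_all add: rename_def)

lemma kernel_rename: "inj_on f (states M) \<Longrightarrow> x \<in> states M \<Longrightarrow> kernel (rename f M) (f x) = map_pmf f (kernel M x)"
  and obs_rename: "inj_on f (states M) \<Longrightarrow> x \<in> states M \<Longrightarrow> obs (rename f M) (f x) = obs M x"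
  by (simp_all add: rename_def)

lemma pomc_rename:
  assumes "pomc M" "inj_on f (states M)" shows "pomc (rename f M)"
  using assms unfolding pomc_def by (auto simp: kernel_rename obs_rename)

lemma history_rename:
  assumes M: "pomc M" and f: "inj_on f (states M)" and a: "a \<in> states M"
  shows "history (rename f M) A (f a) t = map_pmf (map f) (history M A a t)"
proof (induction t)
  case (Suc t)
  have "history (rename f M) A (f a) (Suc t) = bind_pmf (history M A a t) (\<lambda>xs.
      map_pmf (\<lambda>y. map f xs @ [y])
        (kernel (rename f M) (map f xs ! (t - A (map (obs (rename f M)) (map f xs))))))"
    by (simp add: Suc bind_map_pmf)
  also have "\<dots> = bind_pmf (history M A a t) (\<lambda>xs.
      map_pmf (map f) (map_pmf (\<lambda>y. xs @ [y]) (kernel M (xs ! (t - A (map (obs M) xs))))))"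
  proof (rule bind_pmf_cong[OF refl])
    fix xs assume "xs \<in> set_pmf (history M A a t)"
    then have xs: "set xs \<subseteq> states M" "length xs = Suc t"
      using set_history_subset[OF M a] by auto
    have e: "map (obs (rename f M)) (map f xs) = map (obs M) xs"
      using xs f by (auto simp: obs_rename)
    have "xs ! i \<in> states M" if "i \<le> t" for i
      using xs that nth_mem[of i xs] by auto
    then show "map_pmf (\<lambda>y. map f xs @ [y])
        (kernel (rename f M) (map f xs ! (t - A (map (obs (rename f M)) (map f xs)))))
      = map_pmf (map f) (map_pmf (\<lambda>y. xs @ [y]) (kernel M (xs ! (t - A (map (obs M) xs)))))"
      unfolding e using xs f by (simp add: kernel_rename map_pmf_comp)
  qed
  also have "\<dots> = map_pmf (map f) (history M A a (Suc t))"
    by (simp add: map_bind_pmf)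
  finally show ?case .
qed simp

lemma AQC_rename:
  assumes M: "pomc M" and f: "inj_on f (states M)" and a: "a \<in> states M" and b: "b \<in> states M"
  shows "AQC (rename f M) (f a) (f b) = AQC M a b"
proof -
  have "map_pmf (map (obs (rename f M))) (history (rename f M) A (f x) t) = map_pmf (map (obs M)) (history M A x t)"
    if x: "x \<in> states M" for A x t
  proof -
    have "map_pmf (map (obs (rename f M))) (history (rename f M) A (f x) t)
        = map_pmf (\<lambda>xs. map (obs (rename f M)) (map f xs)) (history M A x t)"
      by (simp only: history_rename[OF M f x] map_pmf_comp)
    also have "\<dots> = map_pmf (map (obs M)) (history M A x t)"
      using set_history_subset[OF M x] f by (intro map_pmf_cong refl) (auto simp: obs_rename subset_iff)
    finally show ?thesis .
  qed
  then show ?thesis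
    using a b by (simp add: AQC_def QC_def obs_tv_def obs_prob_def)
qed

section \<open>The encoding of a concrete chain\<close>

locale encoding =
  fixes M :: "('a, 'o) pomc" and r :: "'o \<Rightarrow> nat" and y0 :: 'a
  assumes M: "pomc M" and y0: "y0 \<in> states M"
    and r_inj: "inj_on r (alphabet M)" and r_less: "z \<in> alphabet M \<Longrightarrow> r z < card (alphabet M)"
begin

abbreviation k :: nat where
  "k \<equiv> card (alphabet M)"

text \<open>Outside the state space the kernel is irrelevant; it is made to return to the state space.\<close>

definition E :: "'a \<Rightarrow> ('a \<Rightarrow> real) \<Rightarrow> real" where
  "E x g = (\<Sum>y\<in>states M. pmf (if x \<in> states M then kernel M x else return_pmf y0) y * g y)"

lemma E_kernel: "x \<in> states M \<Longrightarrow> E x g = measure_pmf.expectation (kernel M x) g"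
  unfolding E_def using M
  by (subst integral_measure_pmf[of "states M"]) (auto simp: pomc_def)

sublocale encoded_chain E "obs M" "alphabet M" k r
proof
  fix x x' :: 'a and g h :: "'a \<Rightarrow> real" and g' :: "'a \<Rightarrow> 'a \<Rightarrow> real" and c :: real and z
  show "finite (alphabet M)" using M by (simp add: pomc_def)
  show "E x (\<lambda>y. g y + h y) = E x g + E x h"
    by (simp add: E_def distrib_left sum.distrib)
  show "E x (\<lambda>y. c * g y) = c * E x g"
    by (simp add: E_def sum_distrib_left mult_ac)
  show "E x (\<lambda>y. 1) = 1"
    using sum_pmf_eq_1[of "states M" "if x \<in> states M then kernel M x else return_pmf y0"] M y0
    by (simp add: E_def pomc_def)
  show "E x g = E x h" if "\<And>y. obs M y \<in> alphabet M \<Longrightarrow> g y = h y"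
    unfolding E_def using M that by (intro sum.cong) (auto simp: pomc_def)
  show "E x (\<lambda>y. E x' (g' y)) = E x' (\<lambda>y'. E x (\<lambda>y. g' y y'))"
    unfolding E_def sum_distrib_left by (subst sum.swap) (simp add: mult_ac)
  show "inj_on r (alphabet M)" "z \<in> alphabet M \<Longrightarrow> r z < k"
    using r_inj r_less by auto
qed

interpretation M: pomc_system M E
  by unfold_locales (use M E_kernel in auto)

text \<open>This is the Markov kernel behind \<open>Eh\<close>. Countdown values up to
  \<open>k\<close> suffice, since \<open>Suc (r z) \<le> k\<close> for \<open>z\<close> in the
  alphabet.\<close>

definition encoded :: "(('a \<times> nat) + nat, nat) pomc" where
  "encoded = \<lparr>states = Inl ` (states M \<times> {..k}) \<union> Inr ` {..k},
     kernel = (\<lambda>x. case x of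
        Inl (x, j) \<Rightarrow> if j < k then return_pmf (Inl (x, Suc j))
          else bind_pmf (bernoulli_pmf (1/2)) (\<lambda>b. if b then return_pmf (Inr (Suc (r (obs M x))))
            else map_pmf (\<lambda>y. Inl (y, 0)) (kernel M x))
      | Inr j \<Rightarrow> return_pmf (Inr (j - 1))),
     alphabet = {0, 1},
     obs = obh\<rparr>"

lemma states_encoded: "states encoded = Inl ` (states M \<times> {..k}) \<union> Inr ` {..k}"
  and alphabet_encoded: "alphabet encoded = {0, 1}"
  and obs_encoded: "obs encoded = obh"
  and kernel_encoded: "kernel encoded (Inr j) = return_pmf (Inr (j - 1))"
    "kernel encoded (Inl (x, j)) = (if j < k then return_pmf (Inl (x, Suc j))
          else bind_pmf (bernoulli_pmf (1/2)) (\<lambda>b. if b then return_pmf (Inr (Suc (r (obs M x))))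
            else map_pmf (\<lambda>y. Inl (y, 0)) (kernel M x)))"
  by (simp_all add: encoded_def)

lemma pomc_encoded: "pomc encoded"
proof -
  have "finite (states encoded)" "finite (alphabet encoded)"
    using M by (auto simp: states_encoded alphabet_encoded pomc_def)
  moreover have "obs encoded ` states encoded \<subseteq> alphabet encoded"
    by (auto simp: obs_encoded alphabet_encoded obh_def)
  moreover have "set_pmf (kernel encoded x) \<subseteq> states encoded" if x: "x \<in> states encoded" for x
  proof (cases x)
    case (Inr j)
    with x show ?thesis by (auto simp: states_encoded kernel_encoded)
  next
    case (Inl xj)
    then obtain y j where y: "x = Inl (y, j)" "y \<in> states M" "j \<le> k"
      using x by (cases xj) (auto simp: states_encoded)
    then have "r (obs M y) < k" using r_less M by (auto simp: pomc_def)
    moreover have "set_pmf (kernel M y) \<subseteq> states M"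
      using y M by (auto simp: pomc_def)
    moreover have "set_pmf (kernel encoded x) \<subseteq> (if j < k then {Inl (y, Suc j)}
        else insert (Inr (Suc (r (obs M y)))) ((\<lambda>y. Inl (y, 0)) ` set_pmf (kernel M y)))"
      by (auto simp: y kernel_encoded split: if_splits)
    moreover have "(if j < k then {Inl (y, Suc j)} else insert (Inr (Suc (r (obs M y))))
        ((\<lambda>y. Inl (y, 0)) ` states M)) \<subseteq> states encoded"
      using y \<open>r (obs M y) < k\<close> by (auto simp: states_encoded)
    ultimately show ?thesis by (cases "j < k"; simp only: if_True if_False; blast)
  qed
  ultimately show ?thesis by (simp add: pomc_def)
qed

lemma Eh_kernel:
  assumes "x \<in> states encoded"
  shows "Eh x g = measure_pmf.expectation (kernel encoded x) g"
proof (cases x)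
  case (Inr j)
  then show ?thesis by (simp add: kernel_encoded Eh_simps)
next
  case (Inl xj)
  then obtain y j where y: "x = Inl (y, j)" "y \<in> states M" "j \<le> k"
    using assms by (cases xj) (auto simp: states_encoded)
  show ?thesis
  proof (cases "j < k")
    case True
    then show ?thesis by (simp add: y kernel_encoded Eh_simps)
  next
    case False
    with y have j: "j = k" by simp
    have fin: "finite (set_pmf (kernel M y))"
      using y M finite_subset unfolding pomc_def by blast
    have "measure_pmf.expectation (kernel encoded x) g = (\<Sum>b\<in>UNIV. pmf (bernoulli_pmf (1/2)) b *
        measure_pmf.expectation (if b then return_pmf (Inr (Suc (r (obs M y))))
            else map_pmf (\<lambda>y. Inl (y, 0)) (kernel M y)) g)"
      unfolding y(1) j kernel_encoded using fin
      by (simp only: less_irrefl if_False) (subst pmf_expectation_bind[of UNIV]; auto)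
    also have "\<dots> = Eh x g"
      by (simp add: UNIV_bool y j Eh_simps E_kernel add_divide_distrib)
    finally show ?thesis ..
  qed
qed

lemma H_pomc: "pomc_system encoded Eh"
proof -
  have "query_system Eh (obs encoded) (alphabet encoded)"
    unfolding obs_encoded alphabet_encoded by (rule H.query_system_axioms)
  then show ?thesis
    by (intro pomc_system.intro pomc_system_axioms.intro) (auto simp: pomc_encoded Eh_kernel)
qed

lemma AQC_encoded_le_iff:
  assumes "a \<in> states M" "b \<in> states M"
  shows "AQC encoded (Inl (a, 0)) (Inl (b, 0)) \<le> enat T
    \<longleftrightarrow> 2/3 \<le> H.full_value T (Inl (a, 0)) (Inl (b, 0))"
  using pomc_system.AQC_le_iff[OF H_pomc, of "Inl (a, 0)" "Inl (b, 0)" T] assms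
  unfolding obs_encoded alphabet_encoded by (simp add: states_encoded)

lemma card_alphabet_pos: "0 < k"
proof -
  have "obs M y0 \<in> alphabet M" "finite (alphabet M)"
    using M y0 by (auto simp: pomc_def)
  then show ?thesis by (auto simp: card_gt_0_iff)
qed

lemma AQC_encoded_lower:
  assumes ab: "a \<in> states M" "b \<in> states M"
    and T: "AQC encoded (Inl (a, 0)) (Inl (b, 0)) = enat T"
  obtains m where "AQC M a b \<le> enat m" "k * max 1 m \<le> 2 * T"
proof -
  have v: "2/3 \<le> H.full_value T (Inl (a, 0)) (Inl (b, 0))"
    using AQC_encoded_le_iff[OF ab, of T] T by simp
  have "k < T"
  proof (rule ccontr)
    assume "\<not> k < T"
    then have "H.full_value T (Inl (a, 0)) (Inl (b, 0)) = 0"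
      by (intro full_value_no_information) simp
    with v show False by simp
  qed
  \<comment> \<open>This is the least \<open>m\<close> with \<open>T < Suc k * m\<close>. From
    \<open>k < T\<close> follows \<open>k * m \<le> k + T \<le> 2 * T\<close>, the origin of the
    constant 1/2.\<close>
  define m where "m = Suc (T div Suc k)"
  have "T < Suc k * m"
    unfolding m_def by (metis dividend_less_times_div mult_Suc_right zero_less_Suc)
  then have "H.full_value T (Inl (a, 0)) (Inl (b, 0)) \<le> M.full_value m a b"
    by (intro full_value_upper_bound) (auto simp: M.obs_alphabet ab)
  with v have "AQC M a b \<le> enat m"
    using M.AQC_le_iff[OF ab, of m] by simp
  moreover have "k * max 1 m \<le> 2 * T"
  proof -
    have "k * (T div Suc k) \<le> T"
      by (metis div_times_less_eq_dividend le_trans mult.commute mult_le_mono1 le_SucI le_refl)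
    then show ?thesis using \<open>k < T\<close> by (simp add: m_def)
  qed
  ultimately show ?thesis by (rule that)
qed

lemma AQC_encoded_upper:
  assumes ab: "a \<in> states M" "b \<in> states M" and m: "AQC M a b = enat m"
  shows "AQC encoded (Inl (a, 0)) (Inl (b, 0)) \<le> enat (169 * (k * max 1 m))"
proof -
  have "2/3 \<le> M.full_value m a b"
    using M.AQC_le_iff[OF ab, of m] m by simp
  then have "2/3 \<le> H.full_value (12 * Suc k * (1 + 6 * m) + k) (Inl (a, 0)) (Inl (b, 0))"
    by (intro full_value_lower_bound) (auto simp: M.obs_alphabet ab)
  then have "AQC encoded (Inl (a, 0)) (Inl (b, 0)) \<le> enat (12 * Suc k * (1 + 6 * m) + k)"
    using AQC_encoded_le_iff[OF ab] by blast
  also have "\<dots> \<le> enat (169 * (k * max 1 m))"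
  proof -
    let ?n = "max 1 m"
    \<comment> \<open>The bounds \<open>Suc k \<le> 2 * k\<close> and
      \<open>1 + 6 * m \<le> 7 * ?n\<close> give 12 * 2 * 7 = 168, and the initial path adds
      1.\<close>
    have "12 * Suc k * (1 + 6 * m) + k \<le> 12 * (2 * k) * (7 * ?n) + k * ?n"
      using card_alphabet_pos by (intro add_mono mult_le_mono) auto
    then show ?thesis by simp
  qed
  finally show ?thesis .
qed

lemma AQC_encoded_bounds:
  assumes ab: "a \<in> states M" "b \<in> states M"
  shows "ereal (1/2) * (ereal (real k) * max 1 (ereal_of_enat (AQC M a b)))
      \<le> ereal_of_enat (AQC encoded (Inl (a, 0)) (Inl (b, 0)))"
    and "ereal_of_enat (AQC encoded (Inl (a, 0)) (Inl (b, 0)))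
      \<le> ereal 169 * (ereal (real k) * max 1 (ereal_of_enat (AQC M a b)))"
proof -
  let ?h = "AQC encoded (Inl (a, 0)) (Inl (b, 0))"
  have mx: "max 1 (ereal (real m)) = ereal (real (max 1 m))" for m
    by (simp add: max_def one_ereal_def)
  show "ereal (1/2) * (ereal (real k) * max 1 (ereal_of_enat (AQC M a b))) \<le> ereal_of_enat ?h"
  proof (cases ?h)
    case (enat T)
    then obtain m where m: "AQC M a b \<le> enat m" "k * max 1 m \<le> 2 * T"
      using AQC_encoded_lower[OF ab] by blast
    then obtain m' where m': "AQC M a b = enat m'" "m' \<le> m"
      by (cases "AQC M a b") auto
    have "k * max 1 m' \<le> k * max 1 m" using m' by (intro mult_le_mono) auto
    with m have "real (k * max 1 m') \<le> real (2 * T)" by (simp only: of_nat_le_iff)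
    then have "1/2 * (real k * real (max 1 m')) \<le> real T" by simp
    then show ?thesis
      unfolding enat m'(1) ereal_of_enat_simps mx times_ereal.simps ereal_less_eq .
  qed simp
  show "ereal_of_enat ?h \<le> ereal 169 * (ereal (real k) * max 1 (ereal_of_enat (AQC M a b)))"
  proof (cases "AQC M a b")
    case (enat m)
    from AQC_encoded_upper[OF ab enat] obtain T where T: "?h = enat T" "T \<le> 169 * (k * max 1 m)"
      by (cases ?h) auto
    then have "real T \<le> real (169 * (k * max 1 m))" by (simp only: of_nat_le_iff)
    then have "real T \<le> 169 * (real k * real (max 1 m))" by simp
    then show ?thesis
      unfolding enat T(1) ereal_of_enat_simps mx times_ereal.simps ereal_less_eq .
  next
    case infinity
    \<comment> \<open>A positive alphabet size makes the right-hand side infinite.\<close>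
    then show ?thesis using card_alphabet_pos by (simp add: max_def)
  qed
qed

end

theorem theorem6p2:
  "\<exists>c C :: real. c > 0 \<and> C > 0 \<and>
     (\<forall>M :: ('a, 'o) pomc. pomc M \<longrightarrow>
        (\<exists>(Mh :: (nat, nat) pomc) (\<phi> :: 'a \<Rightarrow> nat).
           canonical Mh \<and> \<phi> ` states M \<subseteq> states Mh \<and> inj_on \<phi> (states M) \<and>
           (\<forall>a\<in>states M. \<forall>a'\<in>states M.
              ereal c * (ereal (real (card (alphabet M))) * max 1 (ereal_of_enat (AQC M a a')))
                \<le> ereal_of_enat (AQC Mh (\<phi> a) (\<phi> a')) \<and>
              ereal_of_enat (AQC Mh (\<phi> a) (\<phi> a'))
                \<le> ereal C * (ereal (real (card (alphabet M))) * max 1 (ereal_of_enat (AQC M a a'))))))"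
proof (rule exI[of _ "1/2"], rule exI[of _ 169], intro conjI allI impI)
  fix M :: "('a, 'o) pomc" assume M: "pomc M"
  show "\<exists>(Mh :: (nat, nat) pomc) (\<phi> :: 'a \<Rightarrow> nat).
           canonical Mh \<and> \<phi> ` states M \<subseteq> states Mh \<and> inj_on \<phi> (states M) \<and>
           (\<forall>a\<in>states M. \<forall>a'\<in>states M.
              ereal (1/2) * (ereal (real (card (alphabet M))) * max 1 (ereal_of_enat (AQC M a a')))
                \<le> ereal_of_enat (AQC Mh (\<phi> a) (\<phi> a')) \<and>
              ereal_of_enat (AQC Mh (\<phi> a) (\<phi> a'))
                \<le> ereal 169 * (ereal (real (card (alphabet M))) * max 1 (ereal_of_enat (AQC M a a'))))"
  proof (cases "states M = {}")
    case True
    \<comment> \<open>Without states there is no \<open>y0\<close> to build the encoding on; a lone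
      sink is canonical and the bounds are vacuous.\<close>
    let ?Mh = "\<lparr>states = {0}, kernel = return_pmf, alphabet = {0, 1}, obs = (\<lambda>_. 1)\<rparr> :: (nat, nat) pomc"
    have "canonical ?Mh" by (simp add: canonical_def pomc_def)
    with True show ?thesis by (intro exI[of _ ?Mh] exI[of _ "\<lambda>_. 0"]) simp
  next
    case False
    then obtain y0 where y0: "y0 \<in> states M" by blast
    have "finite (alphabet M)" using M by (simp add: pomc_def)
    from ex_bij_betw_finite_nat[OF this] obtain r where r: "bij_betw r (alphabet M) {0..<card (alphabet M)}"
      by blast
    interpret encoding M r y0
      by unfold_locales (use M y0 r in \<open>auto simp: bij_betw_def\<close>)
    have "finite (states encoded)" using pomc_encoded by (simp add: pomc_def)
    from finite_imp_inj_to_nat_seg[OF this] obtain f :: "('a \<times> nat) + nat \<Rightarrow> nat" where f: "inj_on f (states encoded)"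
      by blast
    let ?Mh = "rename f encoded" and ?\<phi> = "\<lambda>x. f (Inl (x, 0))"
    have in_states: "Inl (x, 0) \<in> states encoded" if "x \<in> states M" for x
      using that by (simp add: states_encoded)
    have sink: "Inr 0 \<in> states encoded" by (simp add: states_encoded)
    have "canonical ?Mh"
      unfolding canonical_def
    proof (intro conjI bexI ballI)
      show "pomc ?Mh" by (rule pomc_rename[OF pomc_encoded f])
      show "alphabet ?Mh = {0, 1}" by (simp add: alphabet_encoded)
      show "kernel ?Mh (f (Inr 0)) = return_pmf (f (Inr 0))"
        by (simp add: kernel_rename[OF f sink] kernel_encoded)
      show "f (Inr 0) \<in> states ?Mh" using sink by simp
      fix y assume "y \<in> states ?Mh"
      then obtain x where "x \<in> states encoded" "y = f x" by auto
      then show "obs ?Mh y = (if y = f (Inr 0) then 1 else 0)"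
        using f sink by (simp add: obs_rename obs_encoded obh_def inj_on_eq_iff)
    qed
    moreover have "?\<phi> ` states M \<subseteq> states ?Mh"
      using in_states by auto
    moreover have "inj_on ?\<phi> (states M)"
      using f in_states by (auto simp: inj_on_def)
    ultimately show ?thesis
      using AQC_encoded_bounds AQC_rename[OF pomc_encoded f] in_states
      by (intro exI[of _ ?Mh] exI[of _ ?\<phi>]) auto
  qed
qed simp_all

end
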